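(* Let $G$ be a bipartite graph with no parallel edges, let $c\ge 4$ be a fixed even integer, and let $\tilde G$ be a random cyclic $N$-lift of $G$. (i) If $\tilde G$ contains inevitable cycles of length $c$ (i.e., $G$ contains at least one prime zero-permutation TBC walk of length $c$), then, as $N$ tends to infinity, the expected number of cycles of length $c$ in $\tilde G$ is dominated by that of inevitable cycles and grows as $\Theta(N)$. (ii) If $\tilde G$ contains no inevitable cycles of length $c$ (i.e., $G$ contains no prime zero-permutation TBC walk of length $c$), then, as $N$ tends to infinity, the expected number of cycles of length $c$ in $\tilde G$ is $\Theta(1)$ (is asymptotically constant with respect to $N$).
   Context: Graphs are finite. Let $G=(U\cup W,E)$ be bipartite. A cyclic $N$-lift of $G$ is determined by permutation shifts $p_e\in\mathbb Z_N$, $e\in E$: each node $v$ is replaced by $N$ copies $v^0,\dots,v^{N-1}$, and each edge $e=\{u,w\}$ ($u\in U$, $w\in W$) by the $N$ edges $\{u^i,w^{i+p_e \bmod N}\}$, $i\in\mathbb Z_N$. In a random cyclic $N$-lift the $p_e$ are independent and uniformly distributed on $\mathbb Z_N$. A TBC (tailless backtrackless closed) walk of length $c$ is a closed walk with edge sequence $e_1,\dots,e_c$ such that $e_s\ne e_{s+1}$ for $1\le s\le c-1$ and $e_1\ne e_c$. A zero-permutation (ZP) TBC walk is a TBC walk in which each edge is traversed in both directions an equal number of times. A prime ZP TBC walk is a ZP TBC walk that does not contain any (proper) ZP TBC subwalk. Inevitable cycles are the cycles in cyclic lifts of $G$ that occur independently of the lifting degree $N$ and of the choice of permutation shifts; they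 are the inverse images in the lifted graph of the prime ZP TBC walks of $G$. $f(N)=\Theta(g(N))$ means that, for sufficiently large $N$, $a\,g(N)\le f(N)\le b\,g(N)$ for some positive constants $a$ and $b$.
   Formalization: In (ii), O(1) is proved for all N, but the positive lower bound in Θ(1) only along those N for which some cyclic N-lift of G has a cycle of length c; literally (ii) fails, e.g. for trees (expectation 0) or G a 4-cycle, c = 8, N odd. *)

theory Defs
  imports "HOL-Probability.Product_PMF" "HOL-Library.Landau_Symbols" "HOL-Library.Sublist"
begin

text \<open>Edges are two-element vertex sets, so there are no parallel edges.\<close>

definition bipartite_graph :: "'a set \<Rightarrow> 'a set \<Rightarrow> 'a set set \<Rightarrow> bool" where
  "bipartite_graph U W E \<longleftrightarrow>
     finite U \<and> finite W \<and> U \<inter> W = {} \<and> (\<forall>e\<in>E. \<exists>u\<in>U. \<exists>w\<in>W. e = {u, w})"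

text \<open>A walk is given by its list of visited vertices. A closed walk with \<open>c\<close> edges is a list
  of \<open>c + 1\<close> vertices whose first and last entries agree; it has a base point and a direction.\<close>

definition walk_arcs :: "'a list \<Rightarrow> ('a \<times> 'a) list" where
  "walk_arcs xs = zip xs (tl xs)"

definition walk_edges :: "'a list \<Rightarrow> 'a set list" where
  "walk_edges xs = map (\<lambda>(x, y). {x, y}) (walk_arcs xs)"

definition walk_length :: "'a list \<Rightarrow> nat" where
  "walk_length xs = length (walk_edges xs)"

definition closed_walk :: "'a set set \<Rightarrow> 'a list \<Rightarrow> bool" where
  "closed_walk E xs \<longleftrightarrow> walk_length xs \<ge> 1 \<and> set (walk_edges xs) \<subseteq> E \<and> hd xs = last xs"

definition TBC_walk :: "'a set set \<Rightarrow> 'a list \<Rightarrow> bool" where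
  "TBC_walk E xs \<longleftrightarrow> closed_walk E xs \<and> distinct_adj (walk_edges xs) \<and>
     hd (walk_edges xs) \<noteq> last (walk_edges xs)"

definition ZP_TBC_walk :: "'a set set \<Rightarrow> 'a list \<Rightarrow> bool" where
  "ZP_TBC_walk E xs \<longleftrightarrow> TBC_walk E xs \<and>
     (\<forall>x y. count_list (walk_arcs xs) (x, y) = count_list (walk_arcs xs) (y, x))"

text \<open>Subwalks are contiguous and do not pass through the base point of the ambient closed walk.
  Allowing them to do so would not change primality: the complement of a closed ZP subwalk is again
  closed and ZP, and stripping its tails leaves a ZP TBC walk.\<close>

definition prime_ZP_TBC_walk :: "'a set set \<Rightarrow> 'a list \<Rightarrow> bool" where
  "prime_ZP_TBC_walk E xs \<longleftrightarrow> ZP_TBC_walk E xs \<and>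
     \<not> (\<exists>ys. strict_sublist ys xs \<and> ZP_TBC_walk E ys)"

definition cycle_walk :: "'a set set \<Rightarrow> 'a list \<Rightarrow> bool" where
  "cycle_walk E xs \<longleftrightarrow> closed_walk E xs \<and> walk_length xs \<ge> 3 \<and> distinct (tl xs)"

text \<open>A cycle is identified with its edge set, so it is counted once and not once for every
  base point and direction.\<close>

definition cycles :: "'a set set \<Rightarrow> nat \<Rightarrow> 'a set set set" where
  "cycles E c = {set (walk_edges xs) | xs. cycle_walk E xs \<and> walk_length xs = c}"

text \<open>The copy \<open>v\<^sup>i\<close> of the node \<open>v\<close> is the pair \<open>(v, i)\<close>.\<close>

definition cyclic_lift ::
    "'a set \<Rightarrow> 'a set \<Rightarrow> 'a set set \<Rightarrow> nat \<Rightarrow> ('a set \<Rightarrow> nat) \<Rightarrow> ('a \<times> nat) set set" where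
  "cyclic_lift U W E N p =
     {{(u, i), (w, (i + p {u, w}) mod N)} | u w i. u \<in> U \<and> w \<in> W \<and> {u, w} \<in> E \<and> i < N}"

text \<open>The cycles of the lift whose projection to the base graph is a prime ZP TBC walk.\<close>

definition inevitable_cycles ::
    "'a set \<Rightarrow> 'a set \<Rightarrow> 'a set set \<Rightarrow> nat \<Rightarrow> ('a set \<Rightarrow> nat) \<Rightarrow> nat \<Rightarrow> ('a \<times> nat) set set set" where
  "inevitable_cycles U W E N p c =
     {set (walk_edges xs) | xs. cycle_walk (cyclic_lift U W E N p) xs \<and> walk_length xs = c \<and>
        prime_ZP_TBC_walk E (map fst xs)}"

definition random_shifts :: "'a set set \<Rightarrow> nat \<Rightarrow> ('a set \<Rightarrow> nat) pmf" where
  "random_shifts E N = Pi_pmf E 0 (\<lambda>_. pmf_of_set {..<N})"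

definition expected_cycles :: "'a set \<Rightarrow> 'a set \<Rightarrow> 'a set set \<Rightarrow> nat \<Rightarrow> nat \<Rightarrow> real" where
  "expected_cycles U W E c N =
     measure_pmf.expectation (random_shifts E N)
       (\<lambda>p. real (card (cycles (cyclic_lift U W E N p) c)))"

definition expected_inevitable_cycles :: "'a set \<Rightarrow> 'a set \<Rightarrow> 'a set set \<Rightarrow> nat \<Rightarrow> nat \<Rightarrow> real" where
  "expected_inevitable_cycles U W E c N =
     measure_pmf.expectation (random_shifts E N)
       (\<lambda>p. real (card (inevitable_cycles U W E N p c)))"

text \<open>The lifting degrees \<open>N\<close> for which at least one cyclic \<open>N\<close>-lift has a cycle of length \<open>c\<close>.
  For all other \<open>N\<close> the expected number of cycles is exactly \<open>0\<close>, so a positive lower bound can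
  only hold along this set. It can be empty (trees), and it can be neither finite nor cofinite: if
  the base graph is a single 4-cycle, an 8-cycle exists in some cyclic \<open>N\<close>-lift iff \<open>N\<close> is even,
  the expected number of 8-cycles being \<open>1 / 2\<close> for even \<open>N\<close> and \<open>0\<close> for odd \<open>N\<close>.\<close>

definition cycle_degrees :: "'a set \<Rightarrow> 'a set \<Rightarrow> 'a set set \<Rightarrow> nat \<Rightarrow> nat set" where
  "cycle_degrees U W E c =
     {N. \<exists>p. (\<forall>e\<in>E. p e < N) \<and> cycles (cyclic_lift U W E N p) c \<noteq> {}}"

end

theory Submission
  imports Defs "HOL-Number_Theory.Cong"
begin

text \<open>A closed walk of length \<open>c\<close> in the base graph has \<open>N\<close> lifts, one for each starting level, and
  the levels along them are the partial sums of the shifts, each taken with a sign according to the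
  direction of traversal. Such a lift is a cycle iff the total sum is \<open>0\<close> modulo \<open>N\<close> and the sum over
  no proper closed subwalk is. These sums are linear forms in the shifts, whose coefficients are the
  net numbers of traversals. A nonzero form vanishes modulo \<open>N\<close> with probability \<open>O(1/N)\<close>, so
  walks with a nonzero form contribute \<open>O(1)\<close> to the expectation. A walk whose form is zero is ZP;
  if it is not prime, then a proper closed subwalk has form zero and it never lifts to a cycle,
  while if it is prime, it fails to do so only with probability \<open>O(1/N)\<close> and hence contributes
  \<open>\<Theta>(N)\<close>.

  For the lower bound \<open>\<Omega>(1)\<close>, a single choice of shifts with a cycle over a given walk has to be
  amplified. The shifts closing the walk form a subgroup of order at least \<open>N\<^sup>|\<^sup>E\<^sup>| / N\<close>, on
  which the at most \<open>c\<^sup>2\<close> homomorphisms belonging to the proper closed subwalks have to avoid zero.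
  If this is possible at all, then it happens for a proportion of the subgroup that is bounded below
  in terms of the number of homomorphisms only.\<close>

subsection \<open>Counting in subgroups\<close>

text \<open>Here \<open>d\<close> stands for subtraction in a group and \<open>f\<close> for a
  homomorphism. Subtracting a fixed element of a nonempty fibre sends the whole fibre injectively
  into the kernel.\<close>

lemma card_fibre_le_kernel:
  assumes "finite H"
    and closed: "\<And>h k. h \<in> H \<Longrightarrow> k \<in> H \<Longrightarrow> d h k \<in> H"
    and inj: "\<And>k. k \<in> H \<Longrightarrow> inj_on (\<lambda>h. d h k) H"
    and ker: "\<And>h k. h \<in> H \<Longrightarrow> k \<in> H \<Longrightarrow> f h = f k \<Longrightarrow> f (d h k) = z"
  shows "card {h \<in> H. f h = a} \<le> card {h \<in> H. f h = z}"
proof (cases "{h \<in> H. f h = a} = {}")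
  case False
  then obtain k where k: "k \<in> H" "f k = a" by auto
  show ?thesis
  proof (rule card_inj_on_le)
    show "inj_on (\<lambda>h. d h k) {h \<in> H. f h = a}"
      using inj[OF k(1)] by (auto intro: inj_on_subset)
  qed (use assms k in auto)
next
  case True
  then show ?thesis by (metis card.empty le0)
qed

text \<open>If all kernels are small, the union bound suffices; otherwise one passes to a large kernel,
  on which one of the constraints becomes vacuous because \<open>a s \<noteq> z\<close>.\<close>

lemma card_le_card_avoiding:
  assumes "finite S" "card S = m" "finite H"
    and "\<And>h k. h \<in> H \<Longrightarrow> k \<in> H \<Longrightarrow> d h k \<in> H"
    and "\<And>k. k \<in> H \<Longrightarrow> inj_on (\<lambda>h. d h k) H"
    and "\<And>s h k. s \<in> S \<Longrightarrow> h \<in> H \<Longrightarrow> k \<in> H \<Longrightarrow> f s h = f s k \<Longrightarrow> f s (d h k) = z"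
    and "\<And>s. s \<in> S \<Longrightarrow> a s \<noteq> z"
  shows "card H \<le> 2 ^ m * fact m * card {h \<in> H. \<forall>s\<in>S. f s h \<noteq> a s}"
  using assms
proof (induction m arbitrary: S H)
  case 0
  then show ?case by simp
next
  case (Suc m)
  let ?ker = "\<lambda>s. {h \<in> H. f s h = z}"
  let ?good = "{h \<in> H. \<forall>s\<in>S. f s h \<noteq> a s}"
  show ?case
  \<comment> \<open>With this threshold the \<open>Suc m\<close> fibres together fill at most half
    of \<open>H\<close>. When it is exceeded, passing to a kernel costs a factor
    \<open>2 * Suc m\<close>; these factors accumulate to the constant in the claim.\<close>
  proof (cases "\<forall>s\<in>S. 2 * Suc m * card (?ker s) \<le> card H")
    case True
    let ?bad = "\<Union>s\<in>S. {h \<in> H. f s h = a s}"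
    have "card ?bad \<le> (\<Sum>s\<in>S. card {h \<in> H. f s h = a s})"
      using Suc.prems(1) by (rule card_UN_le)
    then have "2 * Suc m * card ?bad \<le> 2 * Suc m * (\<Sum>s\<in>S. card {h \<in> H. f s h = a s})"
      by (rule mult_le_mono2)
    also have "\<dots> = (\<Sum>s\<in>S. 2 * Suc m * card {h \<in> H. f s h = a s})"
      by (simp add: sum_distrib_left)
    also have "\<dots> \<le> (\<Sum>s\<in>S. card H)"
    proof (rule sum_mono)
      fix s assume s: "s \<in> S"
      have "card {h \<in> H. f s h = a s} \<le> card (?ker s)"
        using Suc.prems s by (intro card_fibre_le_kernel[where d = d]) auto
      then have "2 * Suc m * card {h \<in> H. f s h = a s} \<le> 2 * Suc m * card (?ker s)"
        by (rule mult_le_mono2)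
      also have "\<dots> \<le> card H"
        using True s by blast
      finally show "2 * Suc m * card {h \<in> H. f s h = a s} \<le> card H" .
    qed
    also have "\<dots> = Suc m * card H" using Suc.prems by simp
    finally have "Suc m * (2 * card ?bad) \<le> Suc m * card H" by (simp only: mult_ac)
    then have "2 * card ?bad \<le> card H" by (simp only: mult_le_cancel1)
    moreover have "card H \<le> card (?good \<union> ?bad)"
      using Suc.prems(1,3) by (intro card_mono) auto
    then have "card H \<le> card ?good + card ?bad"
      using card_Un_le order_trans by blast
    ultimately have "card H \<le> 2 * card ?good" by linarith
    also have "\<dots> \<le> 2 ^ Suc m * fact (Suc m) * card ?good"
    proof -
      have "(1::nat) * 1 \<le> 2 ^ m * fact (Suc m)"
        by (intro mult_le_mono fact_ge_1) simp
      then have "2 * 1 \<le> 2 * (2 ^ m * fact (Suc m) :: nat)" by linarith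
      then show ?thesis by (intro mult_le_mono1) (simp add: mult.assoc)
    qed
    finally show ?thesis .
  next
    case False
    then obtain s where s: "s \<in> S" "card H < 2 * Suc m * card (?ker s)"
      by (auto simp: not_le)
    have "card (?ker s) \<le> 2 ^ m * fact m * card {h \<in> ?ker s. \<forall>t\<in>S - {s}. f t h \<noteq> a t}"
    proof (rule Suc.IH)
      show "inj_on (\<lambda>h. d h k) (?ker s)" if "k \<in> ?ker s" for k
        using Suc.prems(5)[of k] that by (auto intro: inj_on_subset)
    qed (use Suc.prems s in auto)
    also have "{h \<in> ?ker s. \<forall>t\<in>S - {s}. f t h \<noteq> a t} \<subseteq> ?good"
      using Suc.prems(7) s(1) by fastforce
    then have "card {h \<in> ?ker s. \<forall>t\<in>S - {s}. f t h \<noteq> a t} \<le> card ?good"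
      using Suc.prems(3) by (intro card_mono) auto
    finally have "card (?ker s) \<le> 2 ^ m * fact m * card ?good" by simp
    then have "2 * Suc m * card (?ker s) \<le> 2 * Suc m * (2 ^ m * fact m * card ?good)"
      by (rule mult_le_mono2)
    with s(2) have "card H \<le> 2 * Suc m * (2 ^ m * fact m * card ?good)" by linarith
    then show ?thesis by (simp add: algebra_simps)
  qed
qed

subsection \<open>Linear congruences over a box\<close>

text \<open>The quotient limited here encodes one coordinate of a solution in
  \<open>card_linear_congruence_le\<close>; the added term lies between \<open>- c * N\<close> and
  \<open>c * N\<close>.\<close>

lemma div_add_mult_bounds:
  fixes b k :: int
  assumes "N > 0" "x < N" "\<bar>k\<bar> \<le> int c"
  shows "(b + k * int x) div int N - b div int N \<in> {- int c..int c}"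
proof -
  have "\<bar>k * int x\<bar> \<le> int c * int N"
    unfolding abs_mult using assms by (intro mult_mono) auto
  then have "b - int c * int N \<le> b + k * int x" "b + k * int x \<le> b + int c * int N" by auto
  then have "(b - int c * int N) div int N \<le> (b + k * int x) div int N"
    "(b + k * int x) div int N \<le> (b + int c * int N) div int N"
    using assms(1) by (simp_all only: zdiv_mono1 of_nat_0_less_iff)
  moreover have "(b - int c * int N) div int N = b div int N - int c"
    using assms div_mult_self1[of "int N" b "- int c"] by simp
  moreover have "(b + int c * int N) div int N = b div int N + int c"
    using assms by simp
  ultimately show ?thesis by auto
qed

text \<open>The value \<open>0\<close> outside \<open>A\<close> is the default used by
  \<open>random_shifts\<close>, which for positive \<open>N\<close> is therefore uniform on
  \<open>shift_box E N\<close>.\<close>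

abbreviation shift_box :: "'e set \<Rightarrow> nat \<Rightarrow> ('e \<Rightarrow> nat) set" where
  "shift_box A N \<equiv> PiE_dflt A 0 (\<lambda>_. {..<N})"

lemma finite_shift_box [simp]: "finite A \<Longrightarrow> finite (shift_box A N)"
  by auto

lemma card_shift_box [simp]: "finite A \<Longrightarrow> card (shift_box A N) = N ^ card A"
  by (simp add: card_PiE_dflt)

text \<open>With all coordinates except \<open>e\<close> fixed, the form is a multiple of
  \<open>N\<close> whose quotient has at most \<open>2 * c + 1\<close> possible values, and each of
  them determines \<open>p e\<close> because \<open>n e\<close> is a nonzero integer. Integer
  quotients, in place of an inverse of \<open>n e\<close>, also cover those \<open>N\<close> that
  share factors with \<open>n e\<close>.\<close>

lemma card_linear_congruence_le:
  fixes n :: "'e \<Rightarrow> int"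
  assumes "finite A" "N > 0" "e \<in> A" "n e \<noteq> 0" "\<bar>n e\<bar> \<le> int c"
  shows "card {p \<in> shift_box A N. int N dvd (\<Sum>a\<in>A. n a * int (p a))} * N \<le> (2 * c + 1) * N ^ card A"
proof -
  let ?S = "{p \<in> shift_box A N. int N dvd (\<Sum>a\<in>A. n a * int (p a))}"
  let ?rest = "\<lambda>p. \<Sum>a\<in>A - {e}. n a * int (p a)"
  let ?q = "\<lambda>p. (?rest p + n e * int (p e)) div int N - ?rest p div int N"
  have sum: "(\<Sum>a\<in>A. n a * int (p a)) = ?rest p + n e * int (p e)" for p
    using assms by (simp add: sum.remove[of A e])
  have "card ?S \<le> card (shift_box (A - {e}) N \<times> {- int c..int c})"
  proof (rule card_inj_on_le)
    show "inj_on (\<lambda>p. (p(e := 0), ?q p)) ?S"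
    proof (rule inj_onI)
      fix p p' assume S: "p \<in> ?S" "p' \<in> ?S" and eq: "(p(e := 0), ?q p) = (p'(e := 0), ?q p')"
      then have "p(e := 0) = p'(e := 0)" by simp
      then have off: "p a = p' a" if "a \<noteq> e" for a
        using that by (metis fun_upd_other)
      then have rest: "?rest p = ?rest p'" by (intro sum.cong) auto
      with eq have "(?rest p + n e * int (p e)) div int N = (?rest p' + n e * int (p' e)) div int N"
        by simp
      then have "?rest p + n e * int (p e) = ?rest p' + n e * int (p' e)"
        using S unfolding sum by (metis (no_types, lifting) dvd_mult_div_cancel mem_Collect_eq)
      with rest assms(4) have "p e = p' e" by simp
      with off show "p = p'" by (intro ext) metis
    qed
    have "?q p \<in> {- int c..int c}" if "p \<in> shift_box A N" for p
      using that assms by (intro div_add_mult_bounds) (auto simp: PiE_dflt_def)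
    moreover have "p(e := 0) \<in> shift_box (A - {e}) N" if "p \<in> shift_box A N" for p
      using that by (auto simp: PiE_dflt_def)
    ultimately show "(\<lambda>p. (p(e := 0), ?q p)) ` ?S \<subseteq> shift_box (A - {e}) N \<times> {- int c..int c}"
      by blast
  qed (use assms in auto)
  also have "\<dots> = N ^ (card A - 1) * (2 * c + 1)"
    using assms by (simp add: card_cartesian_product nat_add_distrib)
  finally have "card ?S * N \<le> N ^ (card A - 1) * (2 * c + 1) * N" by (rule mult_le_mono1)
  also have "\<dots> = (2 * c + 1) * N ^ Suc (card A - 1)" by (simp add: mult_ac)
  also have "Suc (card A - 1) = card A"
    using assms by (metis Suc_pred' card_gt_0_iff empty_iff One_nat_def)
  finally show ?thesis .
qed

text \<open>Subtraction in the group of \<open>Z_N\<close>-valued functions on \<open>A\<close>,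
  with representatives below \<open>N\<close>. Adding \<open>N - q a\<close> avoids truncation, as
  \<open>q a < N\<close> on the box.\<close>

definition shift_diff :: "'e set \<Rightarrow> nat \<Rightarrow> ('e \<Rightarrow> nat) \<Rightarrow> ('e \<Rightarrow> nat) \<Rightarrow> 'e \<Rightarrow> nat" where
  "shift_diff A N p q = (\<lambda>a. if a \<in> A then (p a + (N - q a)) mod N else 0)"

lemma shift_diff_in_shift_box [simp]: "N > 0 \<Longrightarrow> shift_diff A N p q \<in> shift_box A N"
  by (auto simp: shift_diff_def PiE_dflt_def)

lemma cong_shift_diff:
  assumes "a \<in> A" "q \<in> shift_box A N"
  shows "[int (shift_diff A N p q a) = int (p a) - int (q a)] (mod int N)"
proof -
  have "q a < N" using assms by (auto simp: PiE_dflt_def)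
  then have "int (p a + (N - q a)) = int (p a) - int (q a) + int N" by simp
  then have "int (shift_diff A N p q a) = (int (p a) - int (q a) + int N) mod int N"
    using assms(1) unfolding shift_diff_def by (simp only: if_True zmod_int)
  then show ?thesis by (simp add: cong_def)
qed

lemma inj_on_shift_diff:
  assumes "q \<in> shift_box A N"
  shows "inj_on (\<lambda>p. shift_diff A N p q) (shift_box A N)"
proof (rule inj_onI)
  fix p p' assume p: "p \<in> shift_box A N" "p' \<in> shift_box A N"
    and eq: "shift_diff A N p q = shift_diff A N p' q"
  show "p = p'"
  proof
    fix a show "p a = p' a"
    proof (cases "a \<in> A")
      case True
      then have "[int (p a) - int (q a) = int (p' a) - int (q a)] (mod int N)"
        using cong_shift_diff[OF True assms, of p] cong_shift_diff[OF True assms, of p'] eq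
        by (metis cong_sym cong_trans)
      then have "[int (p a) - int (q a) + int (q a) = int (p' a) - int (q a) + int (q a)] (mod int N)"
        by (intro cong_add cong_refl)
      then have "[p a = p' a] (mod N)" by (simp add: cong_int_iff)
      then show ?thesis using p True by (auto simp: PiE_dflt_def cong_def)
    qed (use p in \<open>auto simp: PiE_dflt_def\<close>)
  qed
qed

text \<open>Every linear form is thus a homomorphism modulo \<open>N\<close> with respect to
  \<open>shift_diff\<close>.\<close>

lemma cong_sum_shift_diff:
  assumes "q \<in> shift_box A N"
  shows "[(\<Sum>a\<in>A. n a * int (shift_diff A N p q a)) =
    (\<Sum>a\<in>A. n a * int (p a)) - (\<Sum>a\<in>A. n a * int (q a))] (mod int N)"
proof -
  have "[(\<Sum>a\<in>A. n a * int (shift_diff A N p q a)) = (\<Sum>a\<in>A. n a * (int (p a) - int (q a)))] (mod int N)"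
    using assms by (intro cong_sum cong_mult cong_refl cong_shift_diff)
  then show ?thesis by (simp add: algebra_simps sum_subtractf)
qed

text \<open>The form takes at most \<open>N\<close> residues on the box, and no residue has a larger
  fibre than \<open>0\<close>.\<close>

lemma card_linear_congruence_ge:
  fixes n :: "'e \<Rightarrow> int"
  assumes "finite A" "N > 0"
  shows "N ^ card A \<le> N * card {p \<in> shift_box A N. int N dvd (\<Sum>a\<in>A. n a * int (p a))}"
proof -
  let ?f = "\<lambda>p. (\<Sum>a\<in>A. n a * int (p a)) mod int N"
  have "card (shift_box A N) \<le> card (\<Union>r\<in>{0..<int N}. {p \<in> shift_box A N. ?f p = r})"
    using assms by (intro card_mono) auto
  also have "\<dots> \<le> (\<Sum>r\<in>{0..<int N}. card {p \<in> shift_box A N. ?f p = r})"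
    by (rule card_UN_le) simp
  also have "\<dots> \<le> (\<Sum>r\<in>{0..<int N}. card {p \<in> shift_box A N. ?f p = 0})"
  proof (intro sum_mono card_fibre_le_kernel[where d = "shift_diff A N"])
    fix p q assume "p \<in> shift_box A N" "q \<in> shift_box A N" "?f p = ?f q"
    then show "?f (shift_diff A N p q) = 0"
      using cong_sum_shift_diff[of q A N n p] by (simp add: cong_def mod_diff_eq[symmetric])
  qed (use assms inj_on_shift_diff in auto)
  finally show ?thesis using assms by (simp add: dvd_eq_mod_eq_0)
qed

text \<open>A single solution \<open>p\<close> of the constraints yields many of the form \<open>p - h\<close>, where \<open>h\<close> runs
  through the elements of a subgroup that avoid the values attained at \<open>p\<close>.\<close>

lemma card_solutions_ge:
  fixes n :: "'e \<Rightarrow> int" and l :: "'s \<Rightarrow> 'e \<Rightarrow> int"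
  assumes "finite A" "N > 0" "finite S" "p \<in> shift_box A N"
    and "int N dvd (\<Sum>a\<in>A. n a * int (p a))"
    and "\<And>s. s \<in> S \<Longrightarrow> \<not> int N dvd (\<Sum>a\<in>A. l s a * int (p a))"
  shows "N ^ card A \<le> N * (2 ^ card S * fact (card S) *
    card {q \<in> shift_box A N. int N dvd (\<Sum>a\<in>A. n a * int (q a)) \<and>
      (\<forall>s\<in>S. \<not> int N dvd (\<Sum>a\<in>A. l s a * int (q a)))})"
proof -
  define f where "f s p = (\<Sum>a\<in>A. l s a * int (p a)) mod int N" for s p
  define g where "g p = (\<Sum>a\<in>A. n a * int (p a)) mod int N" for p
  define H where "H = {p \<in> shift_box A N. g p = 0}"
  let ?d = "shift_diff A N"
  let ?good = "{q \<in> H. \<forall>s\<in>S. f s q \<noteq> 0}"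
  have box: "q \<in> shift_box A N" if "q \<in> H" for q
    using that by (simp add: H_def)
  have f_diff: "f s (?d p q) = (f s p - f s q) mod int N" if "q \<in> H" for s p q
    using cong_sum_shift_diff[OF box[OF that], of "l s" p]
    by (simp add: cong_def mod_diff_eq f_def)
  have g_diff: "g (?d p q) = (g p - g q) mod int N" if "q \<in> H" for p q
    using cong_sum_shift_diff[OF box[OF that], of n p]
    by (simp add: cong_def mod_diff_eq g_def)
  have inj: "inj_on (\<lambda>h. ?d h k) H" if "k \<in> H" for k
    using inj_on_shift_diff[of k A N] that by (auto simp: H_def intro: inj_on_subset)
  have closed: "?d h k \<in> H" if "h \<in> H" "k \<in> H" for h k
    using that assms(2) g_diff[of k h] by (simp add: H_def)
  have p: "p \<in> H" "\<And>s. s \<in> S \<Longrightarrow> f s p \<noteq> 0"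
    using assms(4,5,6) by (simp_all add: H_def g_def f_def dvd_eq_mod_eq_0)
  have fin: "finite H" using assms(1) by (simp add: H_def)
  \<comment> \<open>The values to avoid are those at \<open>p\<close>, because they are nonzero as
    \<open>card_le_card_avoiding\<close> requires.\<close>
  have "card H \<le> 2 ^ card S * fact (card S) * card {h \<in> H. \<forall>s\<in>S. f s h \<noteq> f s p}"
    by (rule card_le_card_avoiding[where d = ?d and z = 0])
      (use assms(3) fin closed inj p in \<open>simp_all add: f_diff\<close>)
  \<comment> \<open>Subtracting \<open>p\<close> turns avoiding the value at \<open>p\<close> into
    avoiding \<open>0\<close>. The translate used is \<open>h - p\<close>; a form vanishes on it
    exactly when it vanishes on \<open>p - h\<close>.\<close>
  also have "card {h \<in> H. \<forall>s\<in>S. f s h \<noteq> f s p} \<le> card ?good"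
  proof (rule card_inj_on_le)
    show "inj_on (\<lambda>h. ?d h p) {h \<in> H. \<forall>s\<in>S. f s h \<noteq> f s p}"
      using inj[OF p(1)] by (auto intro: inj_on_subset)
    have "f s (?d h p) \<noteq> 0" if "f s h \<noteq> f s p" for s h
    proof
      assume "f s (?d h p) = 0"
      then have "[f s h = f s p] (mod int N)"
        using f_diff[OF p(1), of s h] by (simp add: cong_iff_dvd_diff dvd_eq_mod_eq_0)
      with that show False by (simp add: cong_def f_def)
    qed
    with closed p(1)
    show "(\<lambda>h. ?d h p) ` {h \<in> H. \<forall>s\<in>S. f s h \<noteq> f s p} \<subseteq> ?good"
      by blast
  qed (use fin in simp)
  finally have good: "card H \<le> 2 ^ card S * fact (card S) * card ?good" by simp
  have "N ^ card A \<le> N * card H"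
    using card_linear_congruence_ge[OF assms(1,2), of n]
    by (simp add: H_def g_def dvd_eq_mod_eq_0)
  also have "\<dots> \<le> N * (2 ^ card S * fact (card S) * card ?good)"
    using good by (rule mult_le_mono2)
  finally show ?thesis by (simp add: H_def f_def g_def dvd_eq_mod_eq_0 conj_assoc)
qed

subsection \<open>Walks by index\<close>

lemma length_walk_edges [simp]: "length (walk_edges xs) = length xs - 1"
  by (simp add: walk_edges_def walk_arcs_def)

lemma walk_length_eq: "walk_length xs = length xs - 1"
  by (simp add: walk_length_def)

lemma nth_walk_edges: "Suc k < length xs \<Longrightarrow> walk_edges xs ! k = {xs ! k, xs ! Suc k}"
  by (simp add: walk_edges_def walk_arcs_def nth_tl)

lemma set_walk_edges: "set (walk_edges xs) = {{xs ! k, xs ! Suc k} | k. Suc k < length xs}"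
proof -
  have "set (walk_edges xs) = {walk_edges xs ! k | k. Suc k < length xs}"
    by (auto simp: set_conv_nth less_diff_conv)
  also have "\<dots> = {{xs ! k, xs ! Suc k} | k. Suc k < length xs}"
    using nth_walk_edges by blast
  finally show ?thesis .
qed

text \<open>Carrying the length \<open>c\<close> along on the left makes it available as a bound for
  indices.\<close>

lemma closed_walk_iff:
  "closed_walk E xs \<and> walk_length xs = c \<longleftrightarrow>
    c \<ge> 1 \<and> length xs = Suc c \<and> (\<forall>k<c. {xs ! k, xs ! Suc k} \<in> E) \<and> xs ! 0 = xs ! c"
proof (cases "c \<ge> 1 \<and> length xs = Suc c")
  case True
  then have "xs \<noteq> []" by auto
  then have "hd xs = xs ! 0" "last xs = xs ! c"
    using True by (simp_all add: hd_conv_nth last_conv_nth)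
  moreover have "set (walk_edges xs) \<subseteq> E \<longleftrightarrow> (\<forall>k<c. {xs ! k, xs ! Suc k} \<in> E)"
    using True unfolding set_walk_edges by auto
  ultimately show ?thesis
    using True by (simp add: closed_walk_def walk_length_eq)
next
  case False
  then show ?thesis by (auto simp: closed_walk_def walk_length_eq)
qed

lemma TBC_walk_iff:
  "TBC_walk E xs \<and> walk_length xs = c \<longleftrightarrow>
    closed_walk E xs \<and> walk_length xs = c \<and>
    (\<forall>k. Suc k < c \<longrightarrow> {xs ! k, xs ! Suc k} \<noteq> {xs ! Suc k, xs ! Suc (Suc k)}) \<and>
    {xs ! 0, xs ! 1} \<noteq> {xs ! (c - 1), xs ! c}"
proof (cases "closed_walk E xs \<and> walk_length xs = c")
  case True
  then have c: "c \<ge> 1" "length xs = Suc c"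
    unfolding closed_walk_iff by auto
  then have "walk_edges xs \<noteq> []" by (metis length_walk_edges diff_Suc_1 list.size(3) not_one_le_zero)
  then have "hd (walk_edges xs) = {xs ! 0, xs ! 1}" "last (walk_edges xs) = {xs ! (c - 1), xs ! c}"
    using c nth_walk_edges[of 0 xs] nth_walk_edges[of "c - 1" xs]
    by (simp_all add: hd_conv_nth last_conv_nth)
  moreover have "distinct_adj (walk_edges xs) \<longleftrightarrow>
      (\<forall>k. Suc k < c \<longrightarrow> {xs ! k, xs ! Suc k} \<noteq> {xs ! Suc k, xs ! Suc (Suc k)})"
    using c by (simp add: distinct_adj_conv_nth nth_walk_edges)
  ultimately show ?thesis using True unfolding TBC_walk_def by simp
qed (auto simp: TBC_walk_def)

lemma count_walk_arcs:
  "int (count_list (walk_arcs xs) (x, y)) =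
    (\<Sum>k<length xs - 1. of_bool (xs ! k = x \<and> xs ! Suc k = y))"
proof -
  have "{k. k < length (walk_arcs xs) \<and> (x, y) = walk_arcs xs ! k} =
      {k \<in> {..<length xs - 1}. xs ! k = x \<and> xs ! Suc k = y}"
    by (auto simp: walk_arcs_def nth_tl)
  then show ?thesis
    by (simp add: count_list_eq_length_filter length_filter_conv_card sum.If_cases
        of_bool_def Int_def)
qed

lemma distinct_tl_iff_nth:
  "distinct (tl xs) \<longleftrightarrow> (\<forall>a b. 1 \<le> a \<and> a < b \<and> b < length xs \<longrightarrow> xs ! a \<noteq> xs ! b)"
  (is "?L \<longleftrightarrow> ?R")
proof
  assume ?L
  show ?R
  proof (intro allI impI)
    fix a b assume ab: "1 \<le> a \<and> a < b \<and> b < length xs"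
    then obtain a' b' where "a = Suc a'" "b = Suc b'" by (metis Suc_le_D Suc_lessE One_nat_def)
    with \<open>?L\<close> ab show "xs ! a \<noteq> xs ! b"
      using nth_eq_iff_index_eq[of "tl xs" a' b'] by (simp add: nth_tl less_diff_conv)
  qed
next
  assume R: ?R
  have "tl xs ! i \<noteq> tl xs ! j" if "i < j" "j < length (tl xs)" for i j
    using R[rule_format, of "Suc i" "Suc j"] that by (simp add: nth_tl)
  then show ?L by (auto simp: distinct_conv_nth) (metis nat_neq_iff)
qed

section \<open>Contiguous segments of a walk\<close>

definition segment :: "'a list \<Rightarrow> nat \<Rightarrow> nat \<Rightarrow> 'a list" where
  "segment xs a b = take (Suc (b - a)) (drop a xs)"

lemma length_segment: "a \<le> b \<Longrightarrow> b < length xs \<Longrightarrow> length (segment xs a b) = Suc (b - a)"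
  by (auto simp: segment_def)

lemma nth_segment:
  "a \<le> b \<Longrightarrow> b < length xs \<Longrightarrow> k \<le> b - a \<Longrightarrow> segment xs a b ! k = xs ! (a + k)"
  by (auto simp: segment_def)

lemma sublist_segment: "sublist (segment xs a b) xs"
  unfolding segment_def by (meson sublist_order.order_trans sublist_drop sublist_take)

lemma sublist_eq_segment:
  assumes "sublist ys xs" "ys \<noteq> []"
  obtains a b where "a \<le> b" "b < length xs" "ys = segment xs a b"
proof -
  obtain ps ss where xs: "xs = ps @ ys @ ss" using assms by (auto simp: sublist_def)
  obtain y ys' where ys: "ys = y # ys'" using assms(2) by (cases ys) auto
  show ?thesis
    by (rule that[of "length ps" "length ps + (length ys - 1)"])
      (simp_all add: xs ys segment_def)
qed

subsection \<open>Signed traversals\<close>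

locale bipartite =
  fixes U W :: "'a set" and E :: "'a set set"
  assumes bipartite: "bipartite_graph U W E"
begin

lemma finite_E: "finite E"
proof -
  have "E \<subseteq> Pow (U \<union> W)" using bipartite by (fastforce simp: bipartite_graph_def)
  then show ?thesis using bipartite by (auto simp: bipartite_graph_def intro: finite_subset)
qed

text \<open>The sign with which a shift enters the level: a step from \<open>U\<close> to
  \<open>W\<close> adds it, a step back subtracts it.\<close>

definition orient :: "'a \<Rightarrow> int" where
  "orient x = (if x \<in> U then 1 else - 1)"

lemma abs_orient [simp]: "\<bar>orient x\<bar> = 1"
  by (simp add: orient_def)

lemma edge_cases:
  assumes "{x, y} \<in> E"
  obtains "x \<in> U" "y \<in> W" "y \<notin> U" | "x \<in> W" "y \<in> U" "x \<notin> U"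
  using assms bipartite unfolding bipartite_graph_def by (fastforce simp: doubleton_eq_iff)

lemma orient_edge: "{x, y} \<in> E \<Longrightarrow> orient y = - orient x"
  by (erule edge_cases) (auto simp: orient_def)

lemma edge_neq: "{x, y} \<in> E \<Longrightarrow> x \<noteq> y"
  by (erule edge_cases) auto

text \<open>On a walk of the graph, the net number of traversals of \<open>e\<close> from
  \<open>U\<close> to \<open>W\<close> between the indices \<open>a\<close> and
  \<open>b\<close>.\<close>

definition flow :: "'a list \<Rightarrow> nat \<Rightarrow> nat \<Rightarrow> 'a set \<Rightarrow> int" where
  "flow xs a b e = (\<Sum>k\<in>{a..<b}. if {xs ! k, xs ! Suc k} = e then orient (xs ! k) else 0)"

text \<open>The level reached after \<open>k\<close> steps from level \<open>0\<close>, kept as an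
  integer before reduction modulo \<open>N\<close>.\<close>

definition height :: "('a set \<Rightarrow> nat) \<Rightarrow> 'a list \<Rightarrow> nat \<Rightarrow> int" where
  "height p xs k = (\<Sum>j<k. orient (xs ! j) * int (p {xs ! j, xs ! Suc j}))"

lemma height_0 [simp]: "height p xs 0 = 0"
  by (simp add: height_def)

lemma height_Suc:
  "height p xs (Suc k) = height p xs k + orient (xs ! k) * int (p {xs ! k, xs ! Suc k})"
  by (simp add: height_def)

text \<open>Collecting the steps by the edge they use turns a difference of levels into a linear
  form in the shifts, with the flow as coefficients.\<close>

lemma height_diff:
  assumes "a \<le> b" "\<And>k. a \<le> k \<Longrightarrow> k < b \<Longrightarrow> {xs ! k, xs ! Suc k} \<in> E"
  shows "height p xs b - height p xs a = (\<Sum>e\<in>E. flow xs a b e * int (p e))"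
proof -
  have "height p xs b - height p xs a =
      (\<Sum>k\<in>{a..<b}. orient (xs ! k) * int (p {xs ! k, xs ! Suc k}))"
    using assms(1) unfolding height_def lessThan_atLeast0
    by (subst sum_diff_nat_ivl) auto
  also have "\<dots> = (\<Sum>k\<in>{a..<b}. \<Sum>e\<in>E.
      (if {xs ! k, xs ! Suc k} = e then orient (xs ! k) else 0) * int (p e))"
  proof (intro sum.cong refl)
    fix k assume "k \<in> {a..<b}"
    then have "{xs ! k, xs ! Suc k} \<in> E" using assms(2) by simp
    then show "orient (xs ! k) * int (p {xs ! k, xs ! Suc k}) =
        (\<Sum>e\<in>E. (if {xs ! k, xs ! Suc k} = e then orient (xs ! k) else 0) * int (p e))"
      using finite_E by (simp add: if_distrib[of "\<lambda>z. z * _"] sum.delta cong: if_cong)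
  qed
  also have "\<dots> = (\<Sum>e\<in>E. flow xs a b e * int (p e))"
    unfolding flow_def sum_distrib_right by (rule sum.swap)
  finally show ?thesis .
qed

lemma abs_flow_le:
  assumes "b \<le> c"
  shows "\<bar>flow xs a b e\<bar> \<le> int c"
proof -
  have "\<bar>flow xs a b e\<bar> \<le> (\<Sum>k\<in>{a..<b}. \<bar>if {xs ! k, xs ! Suc k} = e then orient (xs ! k) else 0\<bar>)"
    unfolding flow_def by (rule sum_abs)
  also have "\<dots> \<le> (\<Sum>k\<in>{a..<b}. 1)" by (rule sum_mono) simp
  finally show ?thesis using assms by simp
qed

lemma flow_segment:
  assumes "a \<le> b" "b < length xs"
  shows "flow (segment xs a b) 0 (b - a) e = flow xs a b e"
proof -
  have "flow xs a b e = flow xs (0 + a) (b - a + a) e" using assms by simp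
  also have "\<dots> = flow (segment xs a b) 0 (b - a) e"
    unfolding flow_def sum.shift_bounds_nat_ivl
    using assms by (intro sum.cong refl) (simp add: nth_segment add.commute)
  finally show ?thesis ..
qed

lemma flow_eq_count:
  assumes "x \<in> U" "y \<notin> U"
  shows "flow xs 0 (length xs - 1) {x, y} =
    int (count_list (walk_arcs xs) (x, y)) - int (count_list (walk_arcs xs) (y, x))"
proof -
  have "x \<noteq> y" using assms by auto
  then have "(if {u, v} = {x, y} then orient u else 0) =
      of_bool (u = x \<and> v = y) - of_bool (u = y \<and> v = x)" for u v
    using assms by (auto simp: orient_def doubleton_eq_iff)
  then show ?thesis
    by (simp add: flow_def count_walk_arcs sum_subtractf lessThan_atLeast0)
qed

text \<open>Equal counts in both directions amount to net count zero on each edge. Pairs outside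
  \<open>E\<close> are never traversed, so the edges in \<open>E\<close> suffice.\<close>

lemma ZP_TBC_walk_iff:
  "ZP_TBC_walk E xs \<longleftrightarrow> TBC_walk E xs \<and> (\<forall>e\<in>E. flow xs 0 (walk_length xs) e = 0)"
proof (cases "TBC_walk E xs")
  case True
  then have sub: "set (walk_edges xs) \<subseteq> E" by (simp add: TBC_walk_def closed_walk_def)
  have none: "count_list (walk_arcs xs) (x, y) = 0" if "{x, y} \<notin> E" for x y
    using that sub by (auto simp: walk_edges_def count_list_0_iff)
  have "(\<forall>x y. count_list (walk_arcs xs) (x, y) = count_list (walk_arcs xs) (y, x)) \<longleftrightarrow>
      (\<forall>e\<in>E. flow xs 0 (walk_length xs) e = 0)" (is "?L \<longleftrightarrow> ?R")
  proof
    assume ?L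
    show ?R
    proof
      fix e assume "e \<in> E"
      then obtain x y where "e = {x, y}" "x \<in> U" "y \<notin> U"
        using bipartite by (auto simp: bipartite_graph_def) blast
      then show "flow xs 0 (walk_length xs) e = 0"
        using \<open>?L\<close> flow_eq_count[of x y xs] by (simp add: walk_length_eq)
    qed
  next
    assume R: ?R
    show ?L
    proof (intro allI)
      fix x y
      show "count_list (walk_arcs xs) (x, y) = count_list (walk_arcs xs) (y, x)"
      proof (cases "{x, y} \<in> E")
        case E: True
        then have "{y, x} \<in> E" by (simp add: insert_commute)
        with E R have "flow xs 0 (length xs - 1) {x, y} = 0" "flow xs 0 (length xs - 1) {y, x} = 0"
          by (auto simp: walk_length_eq)
        with E show ?thesis using flow_eq_count[of x y xs] flow_eq_count[of y x xs]
          by (elim edge_cases) auto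
      next
        case False
        then have "{y, x} \<notin> E" by (simp add: insert_commute)
        with False show ?thesis by (simp add: none)
      qed
    qed
  qed
  with True show ?thesis by (simp add: ZP_TBC_walk_def)
qed (simp add: ZP_TBC_walk_def)

text \<open>A shortest closed zero-flow segment of a backtrackless walk is automatically tailless.\<close>

lemma ex_ZP_segment:
  assumes "length xs = Suc c" "\<forall>k<c. {xs ! k, xs ! Suc k} \<in> E"
    and nb: "\<forall>k. Suc k < c \<longrightarrow> {xs ! k, xs ! Suc k} \<noteq> {xs ! Suc k, xs ! Suc (Suc k)}"
    and "a < b" "b \<le> c" "xs ! a = xs ! b" "\<forall>e\<in>E. flow xs a b e = 0"
  shows "\<exists>ys. sublist ys xs \<and> length ys \<le> Suc (b - a) \<and> ZP_TBC_walk E ys"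
  using assms(4-)
proof (induction "b - a" arbitrary: a b rule: less_induct)
  case less
  let ?ys = "segment xs a b"
  have len: "length ?ys = Suc (b - a)" using less.prems assms(1) by (simp add: length_segment)
  have nth: "?ys ! k = xs ! (a + k)" if "k \<le> b - a" for k
    using that less.prems assms(1) by (simp add: nth_segment)
  have cw: "closed_walk E ?ys \<and> walk_length ?ys = b - a"
    unfolding closed_walk_iff using less.prems assms(2) len by (simp add: nth)
  show ?case
  proof (cases "{xs ! a, xs ! Suc a} = {xs ! (b - 1), xs ! b}")
    case False
    then have "TBC_walk E ?ys \<and> walk_length ?ys = b - a"
      unfolding TBC_walk_iff using cw less.prems nb by (auto simp: nth)
    moreover have "\<forall>e\<in>E. flow ?ys 0 (b - a) e = 0"
      using less.prems assms(1) by (simp add: flow_segment)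
    ultimately have "ZP_TBC_walk E ?ys" unfolding ZP_TBC_walk_iff by metis
    then show ?thesis using len sublist_segment by (metis order_refl)
  next
    case True
    have edges: "{xs ! a, xs ! Suc a} \<in> E" "{xs ! (b - 1), xs ! b} \<in> E"
      using assms(2)[rule_format, of a] assms(2)[rule_format, of "b - 1"] less.prems(1,2) by simp_all
    have "xs ! Suc a \<noteq> xs ! a" "xs ! (b - 1) \<noteq> xs ! b" using edges edge_neq by metis+
    with True less.prems(3) have eq: "xs ! Suc a = xs ! (b - 1)" by (auto simp: doubleton_eq_iff)
    \<comment> \<open>A segment of length one would be a loop, and one of length two a
      backtrack.\<close>
    have "Suc a \<noteq> b" using edges eq less.prems(3) \<open>xs ! Suc a \<noteq> xs ! a\<close> by metis
    moreover have "Suc (Suc a) \<noteq> b"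
      using nb True less.prems by (metis Suc_lessD diff_Suc_1 Suc_le_lessD)
    ultimately have lt: "Suc a < b - 1" using less.prems by linarith
    \<comment> \<open>The first and the last step use the same edge in opposite directions, so
      stripping both leaves every flow unchanged.\<close>
    have "flow xs (Suc a) (b - 1) e = 0" if "e \<in> E" for e
    proof -
      let ?t = "\<lambda>k. if {xs ! k, xs ! Suc k} = e then orient (xs ! k) else 0"
      have "flow xs a b e = ?t a + flow xs (Suc a) b e"
        unfolding flow_def using less.prems by (simp add: sum.atLeast_Suc_lessThan)
      also have "flow xs (Suc a) b e = flow xs (Suc a) (b - 1) e + ?t (b - 1)"
        unfolding flow_def using lt by (cases b) auto
      also have "?t (b - 1) = - ?t a"
        using True orient_edge[OF edges(1)] lt eq by simp
      finally show ?thesis using less.prems that by simp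
    qed
    then have "\<exists>ys. sublist ys xs \<and> length ys \<le> Suc (b - 1 - Suc a) \<and> ZP_TBC_walk E ys"
      using lt less.prems eq by (intro less.hyps) auto
    moreover have "Suc (b - 1 - Suc a) \<le> Suc (b - a)" by simp
    ultimately show ?thesis using le_trans by blast
  qed
qed

text \<open>Primality becomes a condition on all proper closed segments, tailless or not, which is
  the form that matches cycles in the lift. A strict ZP subwalk is such a segment; conversely,
  \<open>ex_ZP_segment\<close> finds a ZP TBC walk inside any closed segment of zero flow.\<close>

lemma prime_ZP_TBC_walk_iff:
  "prime_ZP_TBC_walk E xs \<and> walk_length xs = c \<longleftrightarrow>
    TBC_walk E xs \<and> walk_length xs = c \<and> (\<forall>e\<in>E. flow xs 0 c e = 0) \<and>
    (\<forall>a b. a < b \<and> b \<le> c \<and> (a, b) \<noteq> (0, c) \<and> xs ! a = xs ! b \<longrightarrow> (\<exists>e\<in>E. flow xs a b e \<noteq> 0))"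
proof (cases "ZP_TBC_walk E xs \<and> walk_length xs = c")
  case True
  then have len: "length xs = Suc c" and edges: "\<forall>k<c. {xs ! k, xs ! Suc k} \<in> E"
    and nb: "\<forall>k. Suc k < c \<longrightarrow> {xs ! k, xs ! Suc k} \<noteq> {xs ! Suc k, xs ! Suc (Suc k)}"
    using TBC_walk_iff[of E xs c] closed_walk_iff[of E xs c] unfolding ZP_TBC_walk_def by auto
  have "(\<exists>ys. strict_sublist ys xs \<and> ZP_TBC_walk E ys) \<longleftrightarrow>
    (\<exists>a b. a < b \<and> b \<le> c \<and> (a, b) \<noteq> (0, c) \<and> xs ! a = xs ! b \<and> (\<forall>e\<in>E. flow xs a b e = 0))"
    (is "?L \<longleftrightarrow> ?R")
  proof
    assume ?L
    then obtain ys where ys: "sublist ys xs" "ys \<noteq> xs" "ZP_TBC_walk E ys"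
      by (auto simp: strict_sublist_def)
    then have "closed_walk E ys \<and> walk_length ys = walk_length ys"
      by (simp add: ZP_TBC_walk_def TBC_walk_def)
    then have cw: "walk_length ys \<ge> 1" "length ys = Suc (walk_length ys)" "ys ! 0 = ys ! walk_length ys"
      unfolding closed_walk_iff by auto
    then have "ys \<noteq> []" by auto
    then obtain a b where ab: "a \<le> b" "b < length xs" "ys = segment xs a b"
      using sublist_eq_segment[OF ys(1)] by blast
    then have wl: "walk_length ys = b - a" using length_segment[of a b xs] by (simp add: walk_length_eq)
    have "a < b" using wl cw by simp
    moreover have "b \<le> c" using ab len by simp
    moreover have "(a, b) \<noteq> (0, c)" using ys(2) ab(3) len by (auto simp: segment_def)
    moreover have "xs ! a = xs ! b" using cw(3) ab wl by (simp add: nth_segment)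
    moreover have "\<forall>e\<in>E. flow xs a b e = 0"
      using ys(3) wl flow_segment[OF ab(1,2)] unfolding ZP_TBC_walk_iff ab(3) by simp
    ultimately show ?R by blast
  next
    assume ?R
    then obtain a b where ab: "a < b" "b \<le> c" "(a, b) \<noteq> (0, c)" "xs ! a = xs ! b"
      "\<forall>e\<in>E. flow xs a b e = 0" by blast
    obtain ys where ys: "sublist ys xs" "length ys \<le> Suc (b - a)" "ZP_TBC_walk E ys"
      using ex_ZP_segment[OF len edges nb ab(1,2,4,5)] by blast
    \<comment> \<open>The length bound from \<open>ex_ZP_segment\<close> makes the subwalk strictly
      shorter than \<open>xs\<close>.\<close>
    have "b - a < c" using ab by auto
    then have "ys \<noteq> xs" using ys(2) len by auto
    then show ?L using ys by (auto simp: strict_sublist_def)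
  qed
  then show ?thesis using True unfolding prime_ZP_TBC_walk_def ZP_TBC_walk_iff by auto
next
  case False
  then show ?thesis unfolding prime_ZP_TBC_walk_def ZP_TBC_walk_iff by auto
qed

subsection \<open>Lifting walks\<close>

text \<open>One signed congruence covers both directions of traversal, so walks in the lift can be
  followed without distinguishing the side of the current vertex.\<close>

lemma lift_edge_iff:
  assumes "N > 0"
  shows "{(x, i), (y, j)} \<in> cyclic_lift U W E N p \<longleftrightarrow>
    {x, y} \<in> E \<and> i < N \<and> j < N \<and> [int j = int i + orient x * int (p {x, y})] (mod int N)"
    (is "?L \<longleftrightarrow> ?R")
proof
  assume ?L
  then obtain u w k where e: "{(x, i), (y, j)} = {(u, k), (w, (k + p {u, w}) mod N)}"
    and uw: "u \<in> U" "w \<in> W" "{u, w} \<in> E" "k < N"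
    by (auto simp: cyclic_lift_def)
  have w: "w \<notin> U" using uw bipartite by (auto simp: bipartite_graph_def)
  from e consider "x = u" "i = k" "y = w" "j = (k + p {u, w}) mod N"
    | "y = u" "j = k" "x = w" "i = (k + p {u, w}) mod N"
    by (auto simp: doubleton_eq_iff)
  then show ?R
  proof cases
    case 1
    then show ?thesis using uw assms by (simp add: orient_def zmod_int)
  next
    case 2
    have "[int k = int ((k + p {u, w}) mod N) - int (p {u, w})] (mod int N)"
      by (simp add: cong_def zmod_int mod_diff_left_eq)
    then show ?thesis using 2 uw w assms by (simp add: orient_def insert_commute)
  qed
next
  assume R: ?R
  then have "{x, y} \<in> E" by blast
  then show ?L
  proof (cases rule: edge_cases)
    case 1
    then have "[j = i + p {x, y}] (mod N)" using R by (simp add: orient_def flip: cong_int_iff)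
    then have "j = (i + p {x, y}) mod N" using R by (simp add: cong_def)
    then show ?thesis using 1 R by (auto simp: cyclic_lift_def)
  next
    case 2
    then have "[int j = int i - int (p {x, y})] (mod int N)" using R by (simp add: orient_def)
    then have "[int j + int (p {x, y}) = int i - int (p {x, y}) + int (p {x, y})] (mod int N)"
      by (intro cong_add cong_refl)
    then have "[i = j + p {y, x}] (mod N)"
      by (simp add: cong_sym_eq insert_commute flip: cong_int_iff)
    then have "i = (j + p {y, x}) mod N" using R by (simp add: cong_def)
    then have "{(x, i), (y, j)} = {(y, j), (x, (j + p {y, x}) mod N)}" by auto
    moreover have "y \<in> U \<and> x \<in> W \<and> {y, x} \<in> E \<and> j < N"
      using 2 R by (simp add: insert_commute)
    ultimately show ?thesis unfolding cyclic_lift_def by blast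
  qed
qed

definition lift_walk :: "nat \<Rightarrow> ('a set \<Rightarrow> nat) \<Rightarrow> 'a list \<Rightarrow> nat \<Rightarrow> ('a \<times> nat) list" where
  "lift_walk N p xs i =
    map (\<lambda>k. (xs ! k, nat ((int i + height p xs k) mod int N))) [0..<length xs]"

lemma length_lift_walk [simp]: "length (lift_walk N p xs i) = length xs"
  by (simp add: lift_walk_def)

lemma nth_lift_walk:
  "k < length xs \<Longrightarrow> lift_walk N p xs i ! k = (xs ! k, nat ((int i + height p xs k) mod int N))"
  by (simp add: lift_walk_def)

lemma map_fst_lift_walk [simp]: "map fst (lift_walk N p xs i) = xs"
  by (simp add: lift_walk_def o_def map_nth)

text \<open>The starting level \<open>i\<close> cancels, so which vertices of the lifted walk
  coincide depends on the shifts and the base walk only.\<close>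

lemma lift_walk_nth_eq_iff:
  assumes "N > 0" "a < length xs" "b < length xs"
  shows "lift_walk N p xs i ! a = lift_walk N p xs i ! b \<longleftrightarrow>
    xs ! a = xs ! b \<and> int N dvd height p xs b - height p xs a"
proof -
  have "nat (x mod int N) = nat (y mod int N) \<longleftrightarrow> int N dvd y - x" for x y
    using assms(1) by (metis eq_nat_nat_iff mod_eq_dvd_iff of_nat_0_less_iff pos_mod_sign)
  then show ?thesis using assms(2,3) by (simp add: nth_lift_walk)
qed

section \<open>Base walks, their returns, and the cycles above them\<close>

definition base_walks :: "nat \<Rightarrow> 'a list set" where
  "base_walks c = {xs. closed_walk E xs \<and> walk_length xs = c}"

lemma base_walksD:
  assumes "xs \<in> base_walks c"
  shows "length xs = Suc c" "\<And>k. k < c \<Longrightarrow> {xs ! k, xs ! Suc k} \<in> E" "xs ! 0 = xs ! c" "c \<ge> 1"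
  using assms unfolding base_walks_def mem_Collect_eq closed_walk_iff by auto

lemma finite_base_walks: "finite (base_walks c)"
proof (rule finite_subset)
  show "base_walks c \<subseteq> {xs. set xs \<subseteq> \<Union>E \<and> length xs = Suc c}"
  proof (intro subsetI CollectI conjI)
    fix xs assume xs: "xs \<in> base_walks c"
    show "length xs = Suc c" using base_walksD(1)[OF xs] .
    fix x assume "x \<in> set xs"
    then obtain k where k: "k < Suc c" "x = xs ! k"
      using base_walksD(1)[OF xs] by (metis in_set_conv_nth)
    then show "x \<in> \<Union>E"
      using base_walksD(2)[OF xs, of k] base_walksD(2)[OF xs, of 0] base_walksD(3,4)[OF xs]
      by (cases "k = c") auto
  qed
  have "finite (\<Union>E)"
    using bipartite finite_E by (auto simp: bipartite_graph_def)
  then show "finite {xs. set xs \<subseteq> \<Union>E \<and> length xs = Suc c}"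
    by (rule finite_lists_length_eq)
qed

text \<open>Index \<open>0\<close> is left out because on a closed walk it carries the same vertex
  as index \<open>c\<close>; this matches the condition \<open>distinct (tl xs)\<close> on
  cycles.\<close>

definition revisits :: "nat \<Rightarrow> 'a list \<Rightarrow> (nat \<times> nat) set" where
  "revisits c xs = {(a, b). 1 \<le> a \<and> a < b \<and> b \<le> c \<and> xs ! a = xs ! b}"

lemma revisits_subset: "revisits c xs \<subseteq> {1..c} \<times> {1..c}"
  by (auto simp: revisits_def)

lemma finite_revisits [simp]: "finite (revisits c xs)"
  by (rule finite_subset[OF revisits_subset]) simp

lemma card_revisits_le: "card (revisits c xs) \<le> c * c"
  using card_mono[OF _ revisits_subset, of c xs] by simp

text \<open>No starting level appears: for given shifts, either all \<open>N\<close> lifts of a walk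
  are cycles or none is.\<close>

definition lifts_to_cycle :: "nat \<Rightarrow> ('a set \<Rightarrow> nat) \<Rightarrow> nat \<Rightarrow> 'a list \<Rightarrow> bool" where
  "lifts_to_cycle N p c xs \<longleftrightarrow> int N dvd height p xs c \<and>
    (\<forall>(a, b)\<in>revisits c xs. \<not> int N dvd height p xs b - height p xs a)"

text \<open>An edge of the base graph and the level at one end fix the level at the other, so a walk
  in the lift is recovered from its projection and its starting level.\<close>

lemma cycle_walk_lift_iff:
  assumes "N > 0" "c \<ge> 3"
  shows "cycle_walk (cyclic_lift U W E N p) zs \<and> walk_length zs = c \<longleftrightarrow>
    (\<exists>xs i. xs \<in> base_walks c \<and> i < N \<and> lifts_to_cycle N p c xs \<and> zs = lift_walk N p xs i)"
    (is "?L \<longleftrightarrow> ?R")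
proof
  assume L: ?L
  then have cw: "length zs = Suc c" "zs ! 0 = zs ! c" "distinct (tl zs)"
    and edge: "\<And>k. k < c \<Longrightarrow> {zs ! k, zs ! Suc k} \<in> cyclic_lift U W E N p"
    using closed_walk_iff[of "cyclic_lift U W E N p" zs c] by (auto simp: cycle_walk_def)
  define xs i where "xs = map fst zs" and "i = snd (zs ! 0)"
  have len: "length xs = Suc c" and fst: "\<And>k. k \<le> c \<Longrightarrow> fst (zs ! k) = xs ! k"
    using cw(1) by (simp_all add: xs_def)
  have step: "{xs ! k, xs ! Suc k} \<in> E \<and> snd (zs ! k) < N \<and> snd (zs ! Suc k) < N \<and>
      [int (snd (zs ! Suc k)) = int (snd (zs ! k)) + orient (xs ! k) * int (p {xs ! k, xs ! Suc k})] (mod int N)"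
    if "k < c" for k
  proof -
    have "zs ! k = (xs ! k, snd (zs ! k))" "zs ! Suc k = (xs ! Suc k, snd (zs ! Suc k))"
      using fst[of k] fst[of "Suc k"] that by (auto simp: prod_eq_iff)
    then show ?thesis using edge[OF that] lift_edge_iff[OF assms(1)] by metis
  qed
  have snd: "snd (zs ! k) = nat ((int i + height p xs k) mod int N)" if "k \<le> c" for k
    using that
  proof (induction k)
    case 0
    then show ?case using step[of 0] assms(2) by (simp add: i_def)
  next
    case (Suc k)
    let ?t = "orient (xs ! k) * int (p {xs ! k, xs ! Suc k})"
    have "int (snd (zs ! k)) = (int i + height p xs k) mod int N"
      using Suc assms(1) by simp
    then have "[int (snd (zs ! Suc k)) = int i + height p xs k + ?t] (mod int N)"
      using step[of k] Suc.prems by (simp add: cong_def mod_add_left_eq)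
    then have "int (snd (zs ! Suc k)) = (int i + height p xs (Suc k)) mod int N"
      using step[of k] Suc.prems by (simp add: cong_def height_Suc add.assoc)
    then show ?case by (metis nat_int)
  qed
  have zs: "zs = lift_walk N p xs i"
  proof (rule nth_equalityI)
    fix k assume "k < length zs"
    then have "k \<le> c" using cw(1) by simp
    then show "zs ! k = lift_walk N p xs i ! k"
      using fst[of k] snd[of k] len by (simp add: nth_lift_walk prod_eq_iff)
  qed (simp add: cw len)
  have base: "xs \<in> base_walks c"
    unfolding base_walks_def mem_Collect_eq closed_walk_iff
    using step len cw(2) fst[of 0] fst[of c] assms(2) by auto
  have "int N dvd height p xs c"
    using cw(2) lift_walk_nth_eq_iff[OF assms(1), of 0 xs c p i] len by (simp add: zs)
  moreover have "\<not> int N dvd height p xs b - height p xs a" if "(a, b) \<in> revisits c xs" for a b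
    using that cw(3) lift_walk_nth_eq_iff[OF assms(1), of a xs b p i] len
    unfolding zs distinct_tl_iff_nth by (auto simp: revisits_def)
  ultimately have "lifts_to_cycle N p c xs" by (auto simp: lifts_to_cycle_def)
  moreover have "i < N" using step[of 0] assms(2) by (simp add: i_def)
  ultimately show ?R using base zs by blast
next
  assume ?R
  then obtain xs i where xs: "xs \<in> base_walks c" and i: "i < N"
    and good: "lifts_to_cycle N p c xs" and zs: "zs = lift_walk N p xs i" by blast
  note D = base_walksD[OF xs]
  have "{zs ! k, zs ! Suc k} \<in> cyclic_lift U W E N p" if "k < c" for k
  proof -
    let ?t = "orient (xs ! k) * int (p {xs ! k, xs ! Suc k})"
    have "[(int i + height p xs (Suc k)) mod int N = (int i + height p xs k) mod int N + ?t] (mod int N)"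
      by (simp add: cong_def height_Suc mod_add_left_eq add.assoc)
    then show ?thesis
      using that D assms(1) by (simp add: zs nth_lift_walk lift_edge_iff nat_less_iff)
  qed
  moreover have "zs ! 0 = zs ! c"
    using good D by (simp add: zs lift_walk_nth_eq_iff[OF assms(1)] lifts_to_cycle_def)
  ultimately have "closed_walk (cyclic_lift U W E N p) zs \<and> walk_length zs = c"
    unfolding closed_walk_iff using D zs by simp
  moreover have "distinct (tl zs)"
    unfolding distinct_tl_iff_nth using good D
    by (auto simp: zs lift_walk_nth_eq_iff[OF assms(1)] lifts_to_cycle_def revisits_def)
  ultimately show ?L using assms(2) by (simp add: cycle_walk_def)
qed

text \<open>This extends the condition to segments starting at index \<open>0\<close>: the segment
  from \<open>0\<close> to \<open>b\<close> is complementary to the one from \<open>b\<close> to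
  \<open>c\<close>, and the two level differences add up to a multiple of \<open>N\<close>.\<close>

lemma lifts_to_cycle_not_dvd:
  assumes "xs \<in> base_walks c" "lifts_to_cycle N p c xs"
    and "a < b" "b \<le> c" "(a, b) \<noteq> (0, c)" "xs ! a = xs ! b"
  shows "\<not> int N dvd height p xs b - height p xs a"
proof (cases "a = 0")
  case True
  then have "(b, c) \<in> revisits c xs"
    using assms base_walksD(3)[OF assms(1)] by (auto simp: revisits_def)
  then have "\<not> int N dvd height p xs c - height p xs b" "int N dvd height p xs c"
    using assms(2) by (auto simp: lifts_to_cycle_def)
  then show ?thesis using True dvd_diff by fastforce
next
  case False
  then have "(a, b) \<in> revisits c xs" using assms by (auto simp: revisits_def)
  then show ?thesis using assms(2) by (auto simp: lifts_to_cycle_def)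
qed

text \<open>A backtrack would be a return after two steps with level difference \<open>0\<close>. A
  tail would make the level difference between the indices \<open>1\<close> and \<open>c - 1\<close>
  equal to the total one, which \<open>N\<close> divides. Since \<open>c\<close> is at least
  \<open>3\<close>, these returns are proper.\<close>

lemma lifts_to_cycle_imp_TBC:
  assumes "c \<ge> 3" "xs \<in> base_walks c" "lifts_to_cycle N p c xs"
  shows "TBC_walk E xs"
proof -
  note D = base_walksD[OF assms(2)]
  note nd = lifts_to_cycle_not_dvd[OF assms(2,3)]
  have "{xs ! k, xs ! Suc k} \<noteq> {xs ! Suc k, xs ! Suc (Suc k)}" if k: "Suc k < c" for k
  proof
    assume eq: "{xs ! k, xs ! Suc k} = {xs ! Suc k, xs ! Suc (Suc k)}"
    have e: "{xs ! k, xs ! Suc k} \<in> E" using D k by simp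
    have "xs ! k = xs ! Suc (Suc k)" using eq edge_neq[OF e] by (auto simp: doubleton_eq_iff)
    moreover have "height p xs (Suc (Suc k)) - height p xs k = 0"
      using orient_edge[OF e] by (simp add: height_Suc flip: eq)
    ultimately show False using nd[of k "Suc (Suc k)"] k assms(1) by (cases k) auto
  qed
  moreover have "{xs ! 0, xs ! 1} \<noteq> {xs ! (c - 1), xs ! c}"
  proof
    assume eq: "{xs ! 0, xs ! 1} = {xs ! (c - 1), xs ! c}"
    have e: "{xs ! 0, xs ! 1} \<in> E" using D(2)[of 0] D(4) by simp
    have x: "xs ! 1 = xs ! (c - 1)" using eq edge_neq[OF e] D(3) by (auto simp: doubleton_eq_iff)
    have "height p xs c = height p xs (c - 1) + orient (xs ! (c - 1)) * int (p {xs ! (c - 1), xs ! c})"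
      using height_Suc[of p xs "c - 1"] D(4) by simp
    also have "\<dots> = height p xs (c - 1) - height p xs 1"
      unfolding eq[symmetric] unfolding x[symmetric]
      using height_Suc[of p xs 0] orient_edge[OF e] by simp
    finally have "int N dvd height p xs (c - 1) - height p xs 1"
      using assms(3) by (simp add: lifts_to_cycle_def)
    moreover have "1 < c - 1" using assms(1) by linarith
    ultimately show False using nd[of 1 "c - 1"] x by simp
  qed
  ultimately show ?thesis using assms(2) TBC_walk_iff[of E xs c] by (simp add: base_walks_def)
qed

text \<open>A proper closed segment of zero flow would have level difference \<open>0\<close>
  whatever the shifts, forcing a repeated vertex in the lift.\<close>

lemma lifts_to_cycle_imp_prime:
  assumes "c \<ge> 3" "xs \<in> base_walks c" "lifts_to_cycle N p c xs" "\<forall>e\<in>E. flow xs 0 c e = 0"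
  shows "prime_ZP_TBC_walk E xs"
proof -
  note D = base_walksD[OF assms(2)]
  have "\<exists>e\<in>E. flow xs a b e \<noteq> 0"
    if ab: "a < b" "b \<le> c" "(a, b) \<noteq> (0, c)" "xs ! a = xs ! b" for a b
  proof (rule ccontr)
    assume "\<not> ?thesis"
    then have "height p xs b - height p xs a = 0"
      using ab D by (subst height_diff) auto
    then show False using lifts_to_cycle_not_dvd[OF assms(2,3) ab] by simp
  qed
  moreover have "TBC_walk E xs \<and> walk_length xs = c"
    using lifts_to_cycle_imp_TBC[OF assms(1-3)] assms(2) by (simp add: base_walks_def)
  ultimately have "prime_ZP_TBC_walk E xs \<and> walk_length xs = c"
    unfolding prime_ZP_TBC_walk_iff using assms(4) by blast
  then show ?thesis ..
qed

lemma height_eq_flow: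
  assumes "xs \<in> base_walks c"
  shows "height p xs c = (\<Sum>e\<in>E. flow xs 0 c e * int (p e))"
  using height_diff[of 0 c xs p] base_walksD[OF assms] by simp

text \<open>In this form the cycle condition is accessible to the counts of linear congruences over
  \<open>shift_box\<close>.\<close>

lemma lifts_to_cycle_iff_flow:
  assumes "xs \<in> base_walks c"
  shows "lifts_to_cycle N p c xs \<longleftrightarrow> int N dvd (\<Sum>e\<in>E. flow xs 0 c e * int (p e)) \<and>
    (\<forall>s\<in>revisits c xs. \<not> int N dvd (\<Sum>e\<in>E. flow xs (fst s) (snd s) e * int (p e)))"
proof -
  have "height p xs b - height p xs a = (\<Sum>e\<in>E. flow xs a b e * int (p e))"
    if "(a, b) \<in> revisits c xs" for a b
    using that base_walksD[OF assms] by (intro height_diff) (auto simp: revisits_def)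
  then show ?thesis by (auto simp: lifts_to_cycle_def height_eq_flow[OF assms])
qed

subsection \<open>Counting cycles\<close>

definition lifted_cycle :: "nat \<Rightarrow> ('a set \<Rightarrow> nat) \<Rightarrow> 'a list \<Rightarrow> nat \<Rightarrow> ('a \<times> nat) set set" where
  "lifted_cycle N p xs i = set (walk_edges (lift_walk N p xs i))"

text \<open>The union is not disjoint, as a cycle arises from each of its base points and
  directions. Upper bounds tolerate the overlap, and lower bounds use the lifts of a single
  walk.\<close>

lemma cycles_eq:
  assumes "N > 0" "c \<ge> 3"
  shows "cycles (cyclic_lift U W E N p) c =
    (\<Union>xs\<in>{xs \<in> base_walks c. lifts_to_cycle N p c xs}. lifted_cycle N p xs ` {..<N})"
  unfolding cycles_def cycle_walk_lift_iff[OF assms] lifted_cycle_def by blast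

lemma inevitable_cycles_eq:
  assumes "N > 0" "c \<ge> 3"
  shows "inevitable_cycles U W E N p c =
    (\<Union>xs\<in>{xs \<in> base_walks c. lifts_to_cycle N p c xs \<and> prime_ZP_TBC_walk E xs}.
      lifted_cycle N p xs ` {..<N})"
  unfolding inevitable_cycles_def conj_assoc[symmetric] cycle_walk_lift_iff[OF assms] lifted_cycle_def
  by fastforce

text \<open>Different starting levels may give the same edge set. The starting vertex is an endpoint
  of one of these edges, however, and the lifted walk lists \<open>c + 1\<close> vertices, so each
  edge set arises from at most \<open>c + 1\<close> levels.\<close>

lemma card_lifted_cycles_ge:
  assumes "xs \<in> base_walks c" "N > 0"
  shows "N \<le> (c + 1) * card (lifted_cycle N p xs ` {..<N})"
proof -
  note D = base_walksD[OF assms(1)]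
  let ?f = "lifted_cycle N p xs"
  have vert: "\<Union>(?f i) \<subseteq> set (lift_walk N p xs i)" for i
    unfolding lifted_cycle_def set_walk_edges by auto
  have start: "(xs ! 0, i) \<in> \<Union>(?f i)" if "i < N" for i
  proof -
    have "lift_walk N p xs i ! 0 = (xs ! 0, i)" using D that by (simp add: nth_lift_walk)
    moreover have "{lift_walk N p xs i ! 0, lift_walk N p xs i ! Suc 0} \<in> ?f i"
      unfolding lifted_cycle_def set_walk_edges using D by auto
    ultimately show ?thesis by auto
  qed
  have fibre: "card {i \<in> {..<N}. ?f i = F} \<le> c + 1" if F: "F \<in> ?f ` {..<N}" for F
  proof -
    obtain i0 where i0: "F = ?f i0" using F by blast
    have "{i \<in> {..<N}. ?f i = F} \<subseteq> snd ` set (lift_walk N p xs i0)"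
    proof
      fix i assume "i \<in> {i \<in> {..<N}. ?f i = F}"
      then have "(xs ! 0, i) \<in> set (lift_walk N p xs i0)"
        using start[of i] vert[of i0] by (simp add: i0 subset_iff)
      then show "i \<in> snd ` set (lift_walk N p xs i0)" by (rule rev_image_eqI) simp
    qed
    then have "card {i \<in> {..<N}. ?f i = F} \<le> card (snd ` set (lift_walk N p xs i0))"
      by (intro card_mono) auto
    also have "\<dots> \<le> card (set (lift_walk N p xs i0))" by (intro card_image_le) simp
    also have "\<dots> \<le> length (lift_walk N p xs i0)" by (rule card_length)
    finally show ?thesis using D by simp
  qed
  have "card {..<N} \<le> card (\<Union>F\<in>?f ` {..<N}. {i \<in> {..<N}. ?f i = F})"
    by (intro card_mono) auto
  also have "\<dots> \<le> (\<Sum>F\<in>?f ` {..<N}. card {i \<in> {..<N}. ?f i = F})"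
    by (rule card_UN_le) simp
  also have "\<dots> \<le> (\<Sum>F\<in>?f ` {..<N}. c + 1)" using fibre by (intro sum_mono)
  finally show ?thesis by (simp add: mult.commute)
qed

section \<open>Expectations as averages over all shift assignments\<close>

definition total_cycles :: "nat \<Rightarrow> nat \<Rightarrow> nat" where
  "total_cycles c N = (\<Sum>p\<in>shift_box E N. card (cycles (cyclic_lift U W E N p) c))"

definition total_inevitable_cycles :: "nat \<Rightarrow> nat \<Rightarrow> nat" where
  "total_inevitable_cycles c N = (\<Sum>p\<in>shift_box E N. card (inevitable_cycles U W E N p c))"

lemma expectation_random_shifts:
  fixes f :: "('a set \<Rightarrow> nat) \<Rightarrow> real"
  assumes "N > 0"
  shows "measure_pmf.expectation (random_shifts E N) f = (\<Sum>p\<in>shift_box E N. f p) / real N ^ card E"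
proof -
  have "random_shifts E N = pmf_of_set (shift_box E N)"
    unfolding random_shifts_def using assms finite_E by (intro Pi_pmf_of_set) auto
  moreover have "shift_box E N \<noteq> {}" using assms by auto
  ultimately show ?thesis using finite_E by (simp add: integral_pmf_of_set)
qed

lemma expected_cycles_eq:
  "N > 0 \<Longrightarrow> expected_cycles U W E c N = real (total_cycles c N) / real N ^ card E"
  by (simp add: expected_cycles_def total_cycles_def expectation_random_shifts)

lemma expected_inevitable_cycles_eq:
  "N > 0 \<Longrightarrow>
    expected_inevitable_cycles U W E c N = real (total_inevitable_cycles c N) / real N ^ card E"
  by (simp add: expected_inevitable_cycles_def total_inevitable_cycles_def expectation_random_shifts)

lemma finite_cycles:
  assumes "N > 0" "c \<ge> 3"
  shows "finite (cycles (cyclic_lift U W E N p) c)"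
  unfolding cycles_eq[OF assms] using finite_base_walks by simp

lemma inevitable_cycles_subset:
  assumes "N > 0" "c \<ge> 3"
  shows "inevitable_cycles U W E N p c \<subseteq> cycles (cyclic_lift U W E N p) c"
  unfolding cycles_eq[OF assms] inevitable_cycles_eq[OF assms] by auto

lemma total_inevitable_le_total:
  assumes "N > 0" "c \<ge> 3"
  shows "total_inevitable_cycles c N \<le> total_cycles c N"
  unfolding total_inevitable_cycles_def total_cycles_def
  by (intro sum_mono card_mono finite_cycles inevitable_cycles_subset assms)

lemma card_UN_lifted_cycles_le:
  assumes "finite A"
  shows "card (\<Union>xs\<in>A. lifted_cycle N p xs ` {..<N}) \<le> card A * N"
proof -
  have "card (\<Union>xs\<in>A. lifted_cycle N p xs ` {..<N}) \<le> (\<Sum>xs\<in>A. card (lifted_cycle N p xs ` {..<N}))"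
    using assms by (rule card_UN_le)
  also have "\<dots> \<le> (\<Sum>xs\<in>A. N)"
    by (intro sum_mono) (metis card_image_le card_lessThan finite_lessThan)
  finally show ?thesis by simp
qed

text \<open>Whatever the shifts, each of the finitely many base walks has at most \<open>N\<close>
  lifts.\<close>

lemma total_inevitable_le:
  assumes "N > 0" "c \<ge> 3"
  shows "total_inevitable_cycles c N \<le> card (base_walks c) * N * N ^ card E"
proof -
  have "card (inevitable_cycles U W E N p c) \<le> card (base_walks c) * N" for p
  proof -
    let ?A = "{xs \<in> base_walks c. lifts_to_cycle N p c xs \<and> prime_ZP_TBC_walk E xs}"
    have "card (inevitable_cycles U W E N p c) \<le> card ?A * N"
      unfolding inevitable_cycles_eq[OF assms]
      using finite_base_walks by (intro card_UN_lifted_cycles_le) simp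
    also have "\<dots> \<le> card (base_walks c) * N"
      using finite_base_walks by (intro mult_le_mono1 card_mono) auto
    finally show ?thesis .
  qed
  then have "total_inevitable_cycles c N \<le> (\<Sum>p\<in>shift_box E N. card (base_walks c) * N)"
    unfolding total_inevitable_cycles_def by (intro sum_mono)
  then show ?thesis using finite_E by (simp add: mult_ac)
qed

lemma card_dvd_flow_le:
  assumes "N > 0" "b \<le> c" "\<exists>e\<in>E. flow xs a b e \<noteq> 0"
  shows "card {p \<in> shift_box E N. int N dvd (\<Sum>e\<in>E. flow xs a b e * int (p e))} * N
    \<le> (2 * c + 1) * N ^ card E"
proof -
  obtain e where e: "e \<in> E" "flow xs a b e \<noteq> 0" using assms(3) by blast
  then show ?thesis
    using assms finite_E abs_flow_le[OF assms(2)] by (intro card_linear_congruence_le[of E N e]) auto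
qed

text \<open>A cycle that is not inevitable lies over a walk with nonzero flow, which closes up in the lift
  only with probability \<open>O(1/N)\<close>.\<close>

lemma total_le_inevitable:
  assumes "N > 0" "c \<ge> 3"
  shows "total_cycles c N \<le> total_inevitable_cycles c N + card (base_walks c) * (2 * c + 1) * N ^ card E"
proof -
  define A where "A = {xs \<in> base_walks c. \<exists>e\<in>E. flow xs 0 c e \<noteq> 0}"
  define B where "B p = {xs \<in> A. int N dvd (\<Sum>e\<in>E. flow xs 0 c e * int (p e))}" for p
  have fin: "finite A" "finite (B p)" for p using finite_base_walks by (simp_all add: A_def B_def)
  have "card (cycles (cyclic_lift U W E N p) c) \<le> card (inevitable_cycles U W E N p c) + card (B p) * N" for p
  proof -
    \<comment> \<open>Outside \<open>B p\<close>, a walk that lifts to a cycle has zero flow and is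
      therefore prime.\<close>
    have "lifts_to_cycle N p c xs \<Longrightarrow> xs \<in> base_walks c \<Longrightarrow> xs \<notin> B p \<Longrightarrow> prime_ZP_TBC_walk E xs" for xs
      using lifts_to_cycle_imp_prime[OF assms(2)] lifts_to_cycle_iff_flow[of xs c N p]
      by (auto simp: A_def B_def)
    then have "cycles (cyclic_lift U W E N p) c \<subseteq>
        inevitable_cycles U W E N p c \<union> (\<Union>xs\<in>B p. lifted_cycle N p xs ` {..<N})"
      unfolding cycles_eq[OF assms] inevitable_cycles_eq[OF assms] by blast
    then have "card (cycles (cyclic_lift U W E N p) c) \<le>
        card (inevitable_cycles U W E N p c \<union> (\<Union>xs\<in>B p. lifted_cycle N p xs ` {..<N}))"
      using fin finite_subset[OF inevitable_cycles_subset finite_cycles, OF assms assms]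
      by (intro card_mono) auto
    also have "\<dots> \<le> card (inevitable_cycles U W E N p c) + card (\<Union>xs\<in>B p. lifted_cycle N p xs ` {..<N})"
      by (rule card_Un_le)
    also have "card (\<Union>xs\<in>B p. lifted_cycle N p xs ` {..<N}) \<le> card (B p) * N"
      using fin by (intro card_UN_lifted_cycles_le)
    finally show ?thesis by simp
  qed
  then have "total_cycles c N \<le> (\<Sum>p\<in>shift_box E N. card (inevitable_cycles U W E N p c) + card (B p) * N)"
    unfolding total_cycles_def by (rule sum_mono)
  also have "\<dots> = total_inevitable_cycles c N + (\<Sum>p\<in>shift_box E N. card (B p)) * N"
    by (simp add: total_inevitable_cycles_def sum.distrib sum_distrib_right)
  \<comment> \<open>Double counting: each walk of nonzero flow closes up for at most a
    \<open>(2 * c + 1) / N\<close> share of the shifts, which cancels the factor \<open>N\<close>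
    for its lifts.\<close>
  also have "(\<Sum>p\<in>shift_box E N. card (B p)) =
      (\<Sum>xs\<in>A. card {p \<in> shift_box E N. int N dvd (\<Sum>e\<in>E. flow xs 0 c e * int (p e))})"
  proof -
    have "(\<Sum>p\<in>shift_box E N. card (B p)) = (\<Sum>p\<in>shift_box E N. \<Sum>xs\<in>A.
        of_bool (int N dvd (\<Sum>e\<in>E. flow xs 0 c e * int (p e))))"
      using fin by (intro sum.cong refl) (simp add: B_def Int_def)
    also have "\<dots> = (\<Sum>xs\<in>A. \<Sum>p\<in>shift_box E N.
        of_bool (int N dvd (\<Sum>e\<in>E. flow xs 0 c e * int (p e))))"
      by (rule sum.swap)
    also have "\<dots> = (\<Sum>xs\<in>A. card {p \<in> shift_box E N. int N dvd (\<Sum>e\<in>E. flow xs 0 c e * int (p e))})"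
      using finite_E by (intro sum.cong refl) (simp add: Int_def)
    finally show ?thesis .
  qed
  also have "\<dots> * N = (\<Sum>xs\<in>A. card {p \<in> shift_box E N. int N dvd (\<Sum>e\<in>E. flow xs 0 c e * int (p e))} * N)"
    by (simp add: sum_distrib_right)
  also have "\<dots> \<le> (\<Sum>xs\<in>A. (2 * c + 1) * N ^ card E)"
    using assms by (intro sum_mono card_dvd_flow_le) (auto simp: A_def)
  also have "\<dots> \<le> card (base_walks c) * ((2 * c + 1) * N ^ card E)"
    using finite_base_walks by (simp add: A_def card_mono del: mult_Suc)
  finally show ?thesis by (simp only: mult.assoc)
qed

section \<open>Lower bounds from a single base walk\<close>

lemma sum_ge_on_subset:
  fixes f :: "'b \<Rightarrow> nat"
  assumes "finite A" "B \<subseteq> A" "\<And>x. x \<in> B \<Longrightarrow> N \<le> k * f x"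
  shows "N * card B \<le> k * sum f A"
proof -
  have "N * card B = (\<Sum>x\<in>B. N)" by simp
  also have "\<dots> \<le> (\<Sum>x\<in>B. k * f x)" using assms(3) by (rule sum_mono)
  also have "\<dots> = k * sum f B" by (simp add: sum_distrib_left)
  also have "\<dots> \<le> k * sum f A" using assms(1,2) by (intro mult_le_mono2 sum_mono2) auto
  finally show ?thesis .
qed

text \<open>Each choice of shifts under which \<open>xs\<close> lifts to cycles yields at least
  \<open>N / (c + 1)\<close> of them, by \<open>card_lifted_cycles_ge\<close>.\<close>

lemma total_cycles_ge:
  assumes "N > 0" "c \<ge> 3" "xs \<in> base_walks c"
  shows "N * card {p \<in> shift_box E N. lifts_to_cycle N p c xs} \<le> (c + 1) * total_cycles c N"
  unfolding total_cycles_def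
proof (rule sum_ge_on_subset)
  fix p assume "p \<in> {p \<in> shift_box E N. lifts_to_cycle N p c xs}"
  then have "card (lifted_cycle N p xs ` {..<N}) \<le> card (cycles (cyclic_lift U W E N p) c)"
    using assms by (intro card_mono finite_cycles) (auto simp: cycles_eq)
  then show "N \<le> (c + 1) * card (cycles (cyclic_lift U W E N p) c)"
    using card_lifted_cycles_ge[OF assms(3,1), of p] le_trans mult_le_mono2 by blast
qed (use finite_E in auto)

lemma total_inevitable_cycles_ge:
  assumes "N > 0" "c \<ge> 3" "xs \<in> base_walks c" "prime_ZP_TBC_walk E xs"
  shows "N * card {p \<in> shift_box E N. lifts_to_cycle N p c xs} \<le> (c + 1) * total_inevitable_cycles c N"
  unfolding total_inevitable_cycles_def
proof (rule sum_ge_on_subset)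
  fix p assume "p \<in> {p \<in> shift_box E N. lifts_to_cycle N p c xs}"
  then have "card (lifted_cycle N p xs ` {..<N}) \<le> card (inevitable_cycles U W E N p c)"
    using assms finite_base_walks
    by (intro card_mono) (auto simp: inevitable_cycles_eq)
  then show "N \<le> (c + 1) * card (inevitable_cycles U W E N p c)"
    using card_lifted_cycles_ge[OF assms(3,1), of p] le_trans mult_le_mono2 by blast
qed (use finite_E in auto)

text \<open>Zero flow makes the walk close up under all shifts. Each of the at most
  \<open>c * c\<close> returns spoils at most a \<open>(2 * c + 1) / N\<close> share of the shifts,
  and the bound on \<open>N\<close> keeps the total at one half or less.\<close>

lemma total_inevitable_cycles_linear:
  assumes "c \<ge> 3" "prime_ZP_TBC_walk E xs" "walk_length xs = c" "N \<ge> 2 * (c * c * (2 * c + 1))"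
    and "N > 0"
  shows "N * N ^ card E \<le> 2 * (c + 1) * total_inevitable_cycles c N"
proof -
  have prime: "TBC_walk E xs" "\<forall>e\<in>E. flow xs 0 c e = 0"
    "\<forall>a b. a < b \<and> b \<le> c \<and> (a, b) \<noteq> (0, c) \<and> xs ! a = xs ! b \<longrightarrow> (\<exists>e\<in>E. flow xs a b e \<noteq> 0)"
    using prime_ZP_TBC_walk_iff[of xs c] assms(2,3) by auto
  then have base: "xs \<in> base_walks c" using assms(3) by (auto simp: base_walks_def TBC_walk_def)
  let ?good = "{p \<in> shift_box E N. lifts_to_cycle N p c xs}"
  let ?bad = "\<lambda>s. {p \<in> shift_box E N. int N dvd (\<Sum>e\<in>E. flow xs (fst s) (snd s) e * int (p e))}"
  have "shift_box E N \<subseteq> ?good \<union> (\<Union>s\<in>revisits c xs. ?bad s)"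
    using prime(2) by (auto simp: lifts_to_cycle_iff_flow[OF base])
  then have "card (shift_box E N) \<le> card (?good \<union> (\<Union>s\<in>revisits c xs. ?bad s))"
    using finite_E by (intro card_mono) auto
  also have "\<dots> \<le> card ?good + card (\<Union>s\<in>revisits c xs. ?bad s)" by (rule card_Un_le)
  also have "card (\<Union>s\<in>revisits c xs. ?bad s) \<le> (\<Sum>s\<in>revisits c xs. card (?bad s))"
    by (rule card_UN_le) simp
  finally have "N ^ card E \<le> card ?good + (\<Sum>s\<in>revisits c xs. card (?bad s))"
    using finite_E by simp
  moreover have "2 * (\<Sum>s\<in>revisits c xs. card (?bad s)) \<le> N ^ card E"
  proof -
    have "(\<Sum>s\<in>revisits c xs. card (?bad s)) * N = (\<Sum>s\<in>revisits c xs. card (?bad s) * N)"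
      by (rule sum_distrib_right)
    also have "\<dots> \<le> (\<Sum>s\<in>revisits c xs. (2 * c + 1) * N ^ card E)"
      using prime(3) assms(5) by (intro sum_mono card_dvd_flow_le) (auto simp: revisits_def)
    also have "\<dots> = card (revisits c xs) * ((2 * c + 1) * N ^ card E)" by simp
    also have "\<dots> \<le> c * c * ((2 * c + 1) * N ^ card E)"
      by (intro mult_le_mono1 card_revisits_le)
    finally have "2 * ((\<Sum>s\<in>revisits c xs. card (?bad s)) * N) \<le> 2 * (c * c * ((2 * c + 1) * N ^ card E))"
      by (rule mult_le_mono2)
    also have "\<dots> = 2 * (c * c * (2 * c + 1)) * N ^ card E" by (simp only: mult.assoc)
    also have "\<dots> \<le> N * N ^ card E" using assms(4) by (rule mult_le_mono1)
    finally have "N * (2 * (\<Sum>s\<in>revisits c xs. card (?bad s))) \<le> N * N ^ card E"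
      by (simp only: mult_ac)
    then show ?thesis using assms(5) by (simp only: nat_mult_le_cancel_disj)
  qed
  ultimately have "N ^ card E \<le> 2 * card ?good" by linarith
  then have "N * N ^ card E \<le> N * (2 * card ?good)" by (rule mult_le_mono2)
  also have "\<dots> = 2 * (N * card ?good)" by simp
  also have "\<dots> \<le> 2 * ((c + 1) * total_inevitable_cycles c N)"
    using total_inevitable_cycles_ge[OF assms(5,1) base assms(2)] by (rule mult_le_mono2)
  finally show ?thesis by (simp only: mult.assoc)
qed

text \<open>By \<open>card_solutions_ge\<close>, one solution implies that a \<open>1 / N\<close>
  share of the shifts, up to a constant, gives cycles over the same walk. Each of these contributes
  at least \<open>N / (c + 1)\<close> cycles, so \<open>N\<close> cancels and a constant depending
  on \<open>c\<close> only remains.\<close>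

lemma total_cycles_ge_of_cycle_degree:
  assumes "N > 0" "c \<ge> 3" "N \<in> cycle_degrees U W E c"
  shows "N ^ card E \<le> 2 ^ (c * c) * fact (c * c) * (c + 1) * total_cycles c N"
proof -
  obtain p where p: "\<forall>e\<in>E. p e < N" "cycles (cyclic_lift U W E N p) c \<noteq> {}"
    using assms(3) by (auto simp: cycle_degrees_def)
  then obtain xs where xs: "xs \<in> base_walks c" "lifts_to_cycle N p c xs"
    by (auto simp: cycles_eq[OF assms(1,2)])
  \<comment> \<open>\<open>cycle_degrees\<close> leaves \<open>p\<close> free outside
    \<open>E\<close>; resetting it to \<open>0\<close> there puts it into the box.\<close>
  define q where "q = (\<lambda>e. if e \<in> E then p e else 0)"
  have q: "q \<in> shift_box E N" using p(1) by (auto simp: q_def PiE_dflt_def)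
  have "(\<Sum>e\<in>E. n e * int (q e)) = (\<Sum>e\<in>E. n e * int (p e))" for n
    by (intro sum.cong) (auto simp: q_def)
  then have sol: "lifts_to_cycle N q c xs"
    using xs by (simp add: lifts_to_cycle_iff_flow)
  let ?K = "card (revisits c xs)"
  let ?good = "{p \<in> shift_box E N. lifts_to_cycle N p c xs}"
  have "N ^ card E \<le> N * (2 ^ ?K * fact ?K * card ?good)"
    unfolding lifts_to_cycle_iff_flow[OF xs(1)]
    using sol unfolding lifts_to_cycle_iff_flow[OF xs(1)]
    by (intro card_solutions_ge[of _ _ _ q]) (use finite_E assms(1) q in auto)
  also have "\<dots> = 2 ^ ?K * fact ?K * (N * card ?good)" by simp
  also have "\<dots> \<le> 2 ^ (c * c) * fact (c * c) * ((c + 1) * total_cycles c N)"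
    by (intro mult_le_mono power_increasing fact_mono_nat card_revisits_le total_cycles_ge assms xs) simp
  finally show ?thesis by (simp only: mult.assoc)
qed

end

text \<open>The last filter restricts to large \<open>N\<close> in \<open>cycle_degrees\<close>. The
  bound along it is void if this set is finite, and agrees with the one along
  \<open>sequentially\<close> if the set contains all large \<open>N\<close>.\<close>

theorem corollary3:
  fixes U W :: "'a set" and E :: "'a set set" and c :: nat
  assumes "bipartite_graph U W E" and "c \<ge> 4" and "even c"
  shows
    "((\<exists>xs. prime_ZP_TBC_walk E xs \<and> walk_length xs = c) \<longrightarrow>
        expected_cycles U W E c \<sim>[sequentially] expected_inevitable_cycles U W E c \<and>
        expected_cycles U W E c \<in> \<Theta>[sequentially](\<lambda>N. real N)) \<and>
     (\<not> (\<exists>xs. prime_ZP_TBC_walk E xs \<and> walk_length xs = c) \<longrightarrow>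
        expected_cycles U W E c \<in> O[sequentially](\<lambda>N. 1) \<and>
        (eventually (\<lambda>N. N \<in> cycle_degrees U W E c) sequentially \<longrightarrow>
           expected_cycles U W E c \<in> \<Theta>[sequentially](\<lambda>N. 1)) \<and>
        expected_cycles U W E c \<in> \<Theta>[inf sequentially (principal (cycle_degrees U W E c))](\<lambda>N. 1))"
proof -
  interpret bipartite U W E by unfold_locales (fact assms(1))
  let ?e = "expected_cycles U W E c" and ?i = "expected_inevitable_cycles U W E c"
  let ?D = "cycle_degrees U W E c"
  have c: "c \<ge> 3" using assms(2) by simp
  define B where "B = real (card (base_walks c))"
  define C where "C = real (card (base_walks c) * (2 * c + 1))"
  have BC: "B \<ge> 0" "C \<ge> 0" by (simp_all add: B_def C_def)
  have pos: "eventually (\<lambda>N::nat. N > 0) sequentially" by (rule eventually_gt_at_top)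
  have bounds: "?i N \<le> ?e N" "?e N \<le> ?i N + C" "0 \<le> ?i N" "?i N \<le> B * real N" if "N > 0" for N
  proof -
    have M: "real N ^ card E > 0" using that by simp
    show "?i N \<le> ?e N"
      using total_inevitable_le_total[OF that c] M
      by (simp add: expected_cycles_eq expected_inevitable_cycles_eq that divide_right_mono)
    have "real (total_cycles c N) \<le> real (total_inevitable_cycles c N) + C * real N ^ card E"
      using total_le_inevitable[OF that c, THEN of_nat_mono, where 'a = real]
      by (simp only: C_def of_nat_add of_nat_mult of_nat_power)
    then show "?e N \<le> ?i N + C"
      using M by (simp add: expected_cycles_eq expected_inevitable_cycles_eq that field_simps)
    show "0 \<le> ?i N" by (simp add: expected_inevitable_cycles_eq that)
    have "real (total_inevitable_cycles c N) \<le> B * real N * real N ^ card E"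
      using total_inevitable_le[OF that c, THEN of_nat_mono, where 'a = real]
      by (simp only: B_def of_nat_mult of_nat_power)
    then show "?i N \<le> B * real N"
      using M by (simp add: expected_inevitable_cycles_eq that field_simps)
  qed
  have diff: "(\<lambda>N. ?e N - ?i N) \<in> O(\<lambda>_. 1)"
  proof (rule bigoI[where c = C])
    show "\<forall>\<^sub>F N in sequentially. norm (?e N - ?i N) \<le> C * norm (1 :: real)"
      using pos
    proof eventually_elim
      case (elim N)
      then show ?case using bounds(1,2)[OF elim] by simp
    qed
  qed
  show ?thesis
  proof (intro conjI impI)
    assume "\<exists>xs. prime_ZP_TBC_walk E xs \<and> walk_length xs = c"
    then obtain xs where xs: "prime_ZP_TBC_walk E xs" "walk_length xs = c" by blast
    \<comment> \<open>The reciprocal of the factor in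
      \<open>total_inevitable_cycles_linear\<close>.\<close>
    define d where "d = 1 / (2 * (real c + 1))"
    have d: "d > 0" by (simp add: d_def add_pos_nonneg)
    have lower: "eventually (\<lambda>N. d * real N \<le> ?i N) sequentially"
      using eventually_ge_at_top[of "2 * (c * c * (2 * c + 1))"] pos
    proof eventually_elim
      case (elim N)
      have "real (N * N ^ card E) \<le> real (2 * (c + 1) * total_inevitable_cycles c N)"
        using total_inevitable_cycles_linear[OF c xs elim] by (rule of_nat_mono)
      then have "real N * real N ^ card E \<le> 2 * (real c + 1) * real (total_inevitable_cycles c N)"
        by (simp add: algebra_simps)
      then show ?case
        using elim by (simp add: expected_inevitable_cycles_eq d_def field_simps)
    qed
    \<comment> \<open>As \<open>?i\<close> grows at least linearly, a bounded difference is
      negligible against it, which is asymptotic equivalence.\<close>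
    have "real \<in> O(?i)"
      by (rule bigoI[where c = "1 / d"], rule eventually_mono[OF lower])
        (use d in \<open>auto simp: field_simps\<close>)
    moreover have "(\<lambda>_. 1) \<in> o(real)"
      by (rule smalloI_tendsto) (auto intro: lim_const_over_n eventually_gt_at_top[THEN eventually_mono])
    ultimately have "(\<lambda>N. ?e N - ?i N) \<in> o(?i)"
      using diff by (meson landau_o.big_small_trans landau_o.small_big_trans)
    then show "?e \<sim>[sequentially] ?i" by (simp add: asymp_equiv_altdef)
    show "?e \<in> \<Theta>(\<lambda>N. real N)"
    \<comment> \<open>The summand \<open>1\<close> makes the constant positive, since
      \<open>B\<close> and \<open>C\<close> are only known to be nonnegative.\<close>
    proof (rule bigthetaI'[of d "B + C + 1"])
      show "\<forall>\<^sub>F N in sequentially. d * norm (real N) \<le> norm (?e N) \<and>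
          norm (?e N) \<le> (B + C + 1) * norm (real N)"
        using lower pos
      proof eventually_elim
        case (elim N)
        have "C * 1 \<le> C * real N" using elim BC by (intro mult_left_mono) auto
        then have "?e N \<le> (B + C + 1) * real N"
          using bounds[OF elim(2)] by (simp add: algebra_simps)
        then show ?case using bounds[OF elim(2)] elim by simp
      qed
    qed (use d BC in auto)
  next
    assume no_prime: "\<not> (\<exists>xs. prime_ZP_TBC_walk E xs \<and> walk_length xs = c)"
    \<comment> \<open>Without inevitable cycles, the second of the \<open>bounds\<close> leaves
      \<open>?e N\<close> at most \<open>C\<close>.\<close>
    have zero: "?i N = 0" if "N > 0" for N
    proof -
      have "inevitable_cycles U W E N p c = {}" for p
        unfolding inevitable_cycles_eq[OF that c] using no_prime by (auto simp: base_walks_def)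
      then show ?thesis
        by (simp add: expected_inevitable_cycles_eq that total_inevitable_cycles_def)
    qed
    define K :: nat where "K = 2 ^ (c * c) * fact (c * c) * (c + 1)"
    define d where "d = 1 / real K"
    have K: "K > 0" unfolding K_def by simp
    then have d: "d > 0" unfolding d_def by simp
    have upper: "\<bar>?e N\<bar> \<le> C + 1" if "N > 0" for N
      using bounds[OF that] zero[OF that] by simp
    have lower: "d \<le> \<bar>?e N\<bar>" if "N > 0" "N \<in> ?D" for N
    proof -
      have "real (N ^ card E) \<le> real (K * total_cycles c N)"
        using total_cycles_ge_of_cycle_degree[OF that(1) c that(2)] unfolding K_def
        by (rule of_nat_mono)
      then have "d * real N ^ card E \<le> real (total_cycles c N)"
        using K by (simp add: d_def field_simps)
      then show ?thesis using that by (simp add: expected_cycles_eq field_simps)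
    qed
    \<comment> \<open>A general filter \<open>F\<close> serves both \<open>sequentially\<close> and
      its restriction to \<open>?D\<close>.\<close>
    have theta: "?e \<in> \<Theta>[F](\<lambda>_. 1)" if "eventually (\<lambda>N. N > 0 \<and> N \<in> ?D) F" for F
      by (rule bigthetaI'[of d "C + 1"])
        (use d BC upper lower in \<open>auto intro!: eventually_mono[OF that]\<close>)
    show "?e \<in> O(\<lambda>_. 1)"
      by (rule bigoI[where c = "C + 1"], rule eventually_mono[OF pos]) (use upper in simp)
    show "?e \<in> \<Theta>(\<lambda>_. 1)" if "eventually (\<lambda>N. N \<in> ?D) sequentially"
      using that pos by (intro theta) (simp add: eventually_conj)
    show "?e \<in> \<Theta>[inf sequentially (principal ?D)](\<lambda>_. 1)"
    proof (rule theta)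
      show "eventually (\<lambda>N. N > 0 \<and> N \<in> ?D) (inf sequentially (principal ?D))"
        unfolding eventually_inf_principal using pos by eventually_elim simp
    qed
  qed
qed

end
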